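(* There exist $E,F\in\mathcal P^e$ such that $Unl(E)\sim Unl(F)$ but $E\not\approx_{\mathit{wfmust}}F$ and $E\not\approx_{\mathit{sfmust}}F$.
   Context: Unlabeled processes. Let $\mathcal N$ be an infinite set of names and $\omega\notin\mathcal N$ a special success action. Processes $\mathcal P$: $P::=0\mid x(y).P\mid \bar xy.P\mid P\,|\,P\mid(\nu x)P\mid\, !P$; observers $\mathcal O$: the same grammar extended with $\omega.P$. Binders, $fn$, $bn$, $n(\cdot)$ as usual (alpha-conversion assumed; $fn(\omega)=bn(\omega)=\emptyset$). Actions $\mu$: $xy$, $\bar xy$, $\bar x(y)$, $\tau$ (and $\omega$), with $bn(\bar x(y))=\{y\}$, otherwise empty, $fn(xy)=fn(\bar xy)=\{x,y\}$, $fn(\bar x(y))=\{x\}$, $fn(\tau)=\emptyset$. Transitions: Input $x(y).P\xrightarrow{xz}P\{z/y\}$; Output $\bar xy.P\xrightarrow{\bar xy}P$; $\omega.P\xrightarrow{\omega}P$; Open: $P\xrightarrow{\bar xy}P'$, $x\ne y$ imply $(\nu y)P\xrightarrow{\bar x(y)}P'$; Res: $P\xrightarrow{\mu}P'$, $y\notin n(\mu)$ imply $(\nu y)P\xrightarrow{\mu}(\nu y)P'$; Par: $P\xrightarrow{\mu}P'$, $bn(\mu)\cap fn(Q)=\emptyset$ imply $P|Q\xrightarrow{\mu}P'|Q$; Com: $P\xrightarrow{xy}P'$, $Q\xrightarrow{\bar xy}Q'$ imply $P|Q\xrightarrow{\tau}P'|Q'$; Close: $P\xrightarrow{xy}P'$,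 $Q\xrightarrow{\bar x(y)}Q'$, $y\notin fn(P)$ imply $P|Q\xrightarrow{\tau}(\nu y)(P'|Q')$; symmetric versions of Par, Com, Close; Rep: $P\xrightarrow{\mu}P'$ implies $!P\xrightarrow{\mu}P'|!P$. A (strong) bisimulation is a binary relation $\mathcal R$ on processes such that whenever $P\,\mathcal R\,Q$: if $P\xrightarrow{\mu}P'$ then $Q\xrightarrow{\mu}Q'$ for some $Q'$ with $P'\,\mathcal R\,Q'$, and if $Q\xrightarrow{\mu}Q'$ then $P\xrightarrow{\mu}P'$ for some $P'$ with $P'\,\mathcal R\,Q'$. Bisimilarity $\sim$ is the largest bisimulation. Labeled terms. Labels are pairs $\langle s,n\rangle\in\{0,1\}^*\times\mathbb N$; $s_0\sqsubseteq s_1$ means $s_0$ is a prefix of $s_1$; for label sets, $L_0\,\Re\,L_1$ iff for all $\langle s_0,n_0\rangle\in L_0$, $\langle s_1,n_1\rangle\in L_1$: $s_0\not\sqsubseteq s_1$ and $s_1\not\sqsubseteq s_0$. Ground labeled terms: $E::=0\mid \mu_{\langle s,n\rangle}.E\mid(\nu x)E\mid E\,|\,E\mid\, !_{\langle s,n\rangle}P\mid \omega.o$, where $\mu$ is a prefix $x(y)$ or $\bar xy$, $P$ is unlabeled, and $o\in\mathcal O$ is an unlabeled observer. Labeling function: $L_{\langle s,n\rangle}(0)=0$; $L_{\langle s,n\rangle}(\mu.P)=\mu_{\langle s,n\rangle}.L_{\langle s,n+1\rangle}(P)$; $L_{\langle s,n\rangle}(P_0|P_1)=L_{\langle s0,n\rangle}(P_0)|L_{\langle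 s1,n\rangle}(P_1)$; $L_{\langle s,n\rangle}((\nu x)P)=(\nu x)L_{\langle s,n\rangle}(P)$; $L_{\langle s,n\rangle}(!P)=\,!_{\langle s,n\rangle}P$; $L_{\langle s,n\rangle}(\omega.o)=\omega.o$. $top(0)=lab(0)=top(\omega.o)=lab(\omega.o)=\emptyset$; $top(\mu_v.E)=\{v\}$, $lab(\mu_v.E)=\{v\}\cup lab(E)$; $top,lab$ of $(\nu x)E$ equal those of $E$; $top$, $lab$ of $E_0|E_1$ are unions; $top(!_vP)=lab(!_vP)=\{v\}$. $wf$ is the least predicate with: $wf(0)$; $wf(\omega.o)$; $wf(L_{\langle s,n\rangle}(\mu.P))$ for every prefixed process/observer $\mu.P$ and label; $wf(E_0|E_1)$ if $wf(E_0)$, $wf(E_1)$, $top(E_0)\,\Re\,top(E_1)$; $wf((\nu x)E)$ if $wf(E)$; $wf(!_{\langle s,n\rangle}P)$ for every $P$ and label. $\mathcal P^e$ (resp. $\mathcal O^e$) is the set of well-formed labeled terms built from processes (resp. observers). $Unl$ removes all labels ($Unl(\mu_v.E)=\mu.Unl(E)$, $Unl(!_vP)=\,!P$, $Unl(\omega.o)=\omega.o$, homomorphic on $0$, $|$, $\nu$). Labeled transitions use the unlabeled rules with labels ignored (e.g. $x(y)_v.E\xrightarrow{xz}E\{z/y\}$, $\bar xy_v.E\xrightarrow{\bar xy}E$, $\omega.o\xrightarrow{\omega}o$), except replication: if $P\xrightarrow{\mu}P'$ (unlabeled) then $!_{\langle s,n\rangle}P\xrightarrow{\mu}L_{\langle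 s0,n+1\rangle}(P')\,|\,!_{\langle s1,n+1\rangle}P$. Live labels. $live(v,\mu,S)$ is the least predicate closed under: $live(\langle s,n\rangle,xz,x(y)_{\langle s,n\rangle}.S)$; $live(\langle s,n\rangle,\bar xz,\bar xz_{\langle s,n\rangle}.S)$; Res: $live(v,\mu,S)$, $y\notin n(\mu)$ imply $live(v,\mu,(\nu y)S)$; Open: $live(v,\bar xy,S)$, $x\ne y$ imply $live(v,\bar x(y),(\nu y)S)$; Rep: if $P\xrightarrow{\mu}P'$ then $live(\langle s,n\rangle,\mu,!_{\langle s,n\rangle}P)$; Par: $live(v,\mu,S_0)$, $bn(\mu)\cap fn(S_1)=\emptyset$ imply $live(v,\mu,S_0|S_1)$; Com: $live(v,xy,S_0)$, $live(w,\bar xy,S_1)$ imply $live(v,\tau,S_0|S_1)$ and $live(w,\tau,S_0|S_1)$; Close: $live(v,xy,S_0)$, $live(w,\bar x(y),S_1)$, $y\notin fn(S_0)$ imply $live(v,\tau,(\nu y)(S_0|S_1))$ and $live(w,\tau,(\nu y)(S_0|S_1))$ (together with symmetric versions of Par, Com, Close). $Ll(S)=\{v: live(v,\tau,S)\}$. Fair testing. A maximal labeled computation is an infinite sequence $S_0\xrightarrow{\tau}S_1\xrightarrow{\tau}\cdots$ or a finite one ending in a state with no $\tau$-transition. It is weak-fair if for every label $v$ and every index $i$ there is an index $j\ge i$ with $v\notin Ll(S_j)$; strong-fair if for every label $v$ there is an index $i$ with $v\notin Ll(S_j)$ for all indices $j\ge i$ (indices range over the states of the computation). $E$ sfmust $\rho$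 (resp. wfmust) iff every strong-fair (resp. weak-fair) computation from $E|\rho$ contains some $S_i$ with $S_i\xrightarrow{\omega}$. For $\mathit{sat}\in\{\mathit{wfmust},\mathit{sfmust}\}$, $E\approx_{\mathit{sat}}F$ iff for every $\rho\in\mathcal O^e$, $E\ \mathit{sat}\ \rho$ holds exactly when $F\ \mathit{sat}\ \rho$ holds. *)

theory Defs
  imports
    Main
    "HOL-Library.Sublist"
    "HOL-Library.Extended_Nat"
    "HOL-Library.Infinite_Typeclass"
begin

text \<open>
  Names are the elements of a type \<open>'n\<close>; the theorem requires it to be infinite.
  Terms are raw syntax trees. Alpha-conversion is an explicit equivalence, and every transition
  relation (and \<open>live\<close>) is closed under it, so that all of them are relations on terms
  up to alpha-equivalence.
\<close>

text \<open>
  The type is the grammar of observers; \<open>Omg\<close> is the prefix by the success action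
  \<open>\<omega>\<close>. Processes are the terms without \<open>Omg\<close>.
\<close>

datatype 'n pi =
    Null
  | Inp 'n 'n "'n pi"   \<comment> \<open>\<open>x(y).P\<close>\<close>
  | Outp 'n 'n "'n pi"  \<comment> \<open>\<open>\<bar>x y.P\<close>, the output of \<open>y\<close> on \<open>x\<close>\<close>
  | Par "'n pi" "'n pi"
  | Nu 'n "'n pi"
  | Bang "'n pi"
  | Omg "'n pi"

primrec is_proc :: "'n pi \<Rightarrow> bool" where
  "is_proc Null \<longleftrightarrow> True"
| "is_proc (Inp x y P) \<longleftrightarrow> is_proc P"
| "is_proc (Outp x y P) \<longleftrightarrow> is_proc P"
| "is_proc (Par P Q) \<longleftrightarrow> is_proc P \<and> is_proc Q"
| "is_proc (Nu x P) \<longleftrightarrow> is_proc P"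
| "is_proc (Bang P) \<longleftrightarrow> is_proc P"
| "is_proc (Omg P) \<longleftrightarrow> False"

primrec fn :: "'n pi \<Rightarrow> 'n set" where
  "fn Null = {}"
| "fn (Inp x y P) = {x} \<union> (fn P - {y})"
| "fn (Outp x y P) = {x, y} \<union> fn P"
| "fn (Par P Q) = fn P \<union> fn Q"
| "fn (Nu x P) = fn P - {x}"
| "fn (Bang P) = fn P"
| "fn (Omg P) = fn P"

text \<open>
  Capture-avoiding simultaneous substitution. Below a binder \<open>y\<close> the names in
  \<open>\<sigma> ` (fn P - {y})\<close> must not be captured; \<open>y\<close> is kept if it is not one of
  them and is renamed to a fresh name otherwise.
\<close>

definition refresh :: "'n \<Rightarrow> 'n set \<Rightarrow> 'n" where
  "refresh y A = (if y \<notin> A then y else (SOME w. w \<notin> A))"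

primrec subst :: "('n \<Rightarrow> 'n) \<Rightarrow> 'n pi \<Rightarrow> 'n pi" where
  "subst \<sigma> Null = Null"
| "subst \<sigma> (Inp x y P) =
     (let w = refresh y (\<sigma> ` (fn P - {y})) in Inp (\<sigma> x) w (subst (\<sigma>(y := w)) P))"
| "subst \<sigma> (Outp x y P) = Outp (\<sigma> x) (\<sigma> y) (subst \<sigma> P)"
| "subst \<sigma> (Par P Q) = Par (subst \<sigma> P) (subst \<sigma> Q)"
| "subst \<sigma> (Nu y P) =
     (let w = refresh y (\<sigma> ` (fn P - {y})) in Nu w (subst (\<sigma>(y := w)) P))"
| "subst \<sigma> (Bang P) = Bang (subst \<sigma> P)"
| "subst \<sigma> (Omg P) = Omg (subst \<sigma> P)"

text \<open>\<open>subst1 z y P\<close> is \<open>P{z/y}\<close>.\<close>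

definition subst1 :: "'n \<Rightarrow> 'n \<Rightarrow> 'n pi \<Rightarrow> 'n pi" where
  "subst1 z y P = subst (id(y := z)) P"

inductive alpha :: "'n pi \<Rightarrow> 'n pi \<Rightarrow> bool" where
  alpha_refl: "alpha P P"
| alpha_sym: "alpha P Q \<Longrightarrow> alpha Q P"
| alpha_trans: "alpha P Q \<Longrightarrow> alpha Q R \<Longrightarrow> alpha P R"
| alpha_Inp_rename: "z \<notin> fn P \<Longrightarrow> alpha (Inp x y P) (Inp x z (subst1 z y P))"
| alpha_Nu_rename: "z \<notin> fn P \<Longrightarrow> alpha (Nu y P) (Nu z (subst1 z y P))"
| alpha_Inp: "alpha P Q \<Longrightarrow> alpha (Inp x y P) (Inp x y Q)"
| alpha_Outp: "alpha P Q \<Longrightarrow> alpha (Outp x y P) (Outp x y Q)"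
| alpha_Par: "alpha P P' \<Longrightarrow> alpha Q Q' \<Longrightarrow> alpha (Par P Q) (Par P' Q')"
| alpha_Nu: "alpha P Q \<Longrightarrow> alpha (Nu x P) (Nu x Q)"
| alpha_Bang: "alpha P Q \<Longrightarrow> alpha (Bang P) (Bang Q)"
| alpha_Omg: "alpha P Q \<Longrightarrow> alpha (Omg P) (Omg Q)"

datatype 'n action =
    AIn 'n 'n    \<comment> \<open>\<open>x y\<close>\<close>
  | AOut 'n 'n   \<comment> \<open>\<open>\<bar>x y\<close>\<close>
  | ABOut 'n 'n  \<comment> \<open>\<open>\<bar>x(y)\<close>\<close>
  | ATau
  | AOmg

primrec act_bn :: "'n action \<Rightarrow> 'n set" where
  "act_bn (AIn x y) = {}"
| "act_bn (AOut x y) = {}"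
| "act_bn (ABOut x y) = {y}"
| "act_bn ATau = {}"
| "act_bn AOmg = {}"

primrec act_fn :: "'n action \<Rightarrow> 'n set" where
  "act_fn (AIn x y) = {x, y}"
| "act_fn (AOut x y) = {x, y}"
| "act_fn (ABOut x y) = {x}"
| "act_fn ATau = {}"
| "act_fn AOmg = {}"

definition act_n :: "'n action \<Rightarrow> 'n set" where
  "act_n \<mu> = act_fn \<mu> \<union> act_bn \<mu>"

inductive step :: "'n pi \<Rightarrow> 'n action \<Rightarrow> 'n pi \<Rightarrow> bool" where
  Input: "step (Inp x y P) (AIn x z) (subst1 z y P)"
| Output: "step (Outp x y P) (AOut x y) P"
| Omega: "step (Omg P) AOmg P"
| Open: "step P (AOut x y) P' \<Longrightarrow> x \<noteq> y \<Longrightarrow> step (Nu y P) (ABOut x y) P'"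
| Res: "step P \<mu> P' \<Longrightarrow> y \<notin> act_n \<mu> \<Longrightarrow> step (Nu y P) \<mu> (Nu y P')"
| Par1: "step P \<mu> P' \<Longrightarrow> act_bn \<mu> \<inter> fn Q = {} \<Longrightarrow> step (Par P Q) \<mu> (Par P' Q)"
| Par2: "step Q \<mu> Q' \<Longrightarrow> act_bn \<mu> \<inter> fn P = {} \<Longrightarrow> step (Par P Q) \<mu> (Par P Q')"
| Com1: "step P (AIn x y) P' \<Longrightarrow> step Q (AOut x y) Q' \<Longrightarrow>
    step (Par P Q) ATau (Par P' Q')"
| Com2: "step P (AOut x y) P' \<Longrightarrow> step Q (AIn x y) Q' \<Longrightarrow>
    step (Par P Q) ATau (Par P' Q')"
| Close1: "step P (AIn x y) P' \<Longrightarrow> step Q (ABOut x y) Q' \<Longrightarrow> y \<notin> fn P \<Longrightarrow>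
    step (Par P Q) ATau (Nu y (Par P' Q'))"
| Close2: "step P (ABOut x y) P' \<Longrightarrow> step Q (AIn x y) Q' \<Longrightarrow> y \<notin> fn Q \<Longrightarrow>
    step (Par P Q) ATau (Nu y (Par P' Q'))"
| Rep: "step P \<mu> P' \<Longrightarrow> step (Bang P) \<mu> (Par P' (Bang P))"
| Alpha: "alpha P Q \<Longrightarrow> step Q \<mu> Q' \<Longrightarrow> alpha Q' P' \<Longrightarrow> step P \<mu> P'"

definition bisimulation :: "('n pi \<Rightarrow> 'n pi \<Rightarrow> bool) \<Rightarrow> bool" where
  "bisimulation R \<longleftrightarrow> (\<forall>P Q. R P Q \<longrightarrow>
     is_proc P \<and> is_proc Q \<and>
     (\<forall>\<mu> P'. step P \<mu> P' \<longrightarrow> (\<exists>Q'. step Q \<mu> Q' \<and> R P' Q')) \<and>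
     (\<forall>\<mu> Q'. step Q \<mu> Q' \<longrightarrow> (\<exists>P'. step P \<mu> P' \<and> R P' Q')))"

definition bisimilar :: "'n pi \<Rightarrow> 'n pi \<Rightarrow> bool" where
  "bisimilar P Q \<longleftrightarrow> (\<exists>R. bisimulation R \<and> R P Q)"

text \<open>In the string component, \<open>False\<close> stands for 0 and \<open>True\<close> for 1.\<close>

type_synonym label = "bool list \<times> nat"

definition unrelated :: "label set \<Rightarrow> label set \<Rightarrow> bool" where
  "unrelated L0 L1 \<longleftrightarrow>
     (\<forall>(s0, n0) \<in> L0. \<forall>(s1, n1) \<in> L1. \<not> prefix s0 s1 \<and> \<not> prefix s1 s0)"

text \<open>
  \<open>LObs p\<close> is not part of the grammar of labelled terms. The rule
  \<open>\<omega>.o \<longrightarrow> o\<close> turns a labelled term into an unlabelled observer, and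
  \<open>LObs o\<close> is that observer, as it occurs in the target of an \<open>\<omega>\<close>-transition.
  No well-formed term contains \<open>LObs\<close>.
\<close>

datatype 'n lterm =
    LNull
  | LInp 'n 'n label "'n lterm"
  | LOutp 'n 'n label "'n lterm"
  | LNu 'n "'n lterm"
  | LPar "'n lterm" "'n lterm"
  | LBang label "'n pi"
  | LOmg "'n pi"
  | LObs "'n pi"

primrec is_lproc :: "'n lterm \<Rightarrow> bool" where
  "is_lproc LNull \<longleftrightarrow> True"
| "is_lproc (LInp x y v E) \<longleftrightarrow> is_lproc E"
| "is_lproc (LOutp x y v E) \<longleftrightarrow> is_lproc E"
| "is_lproc (LNu x E) \<longleftrightarrow> is_lproc E"
| "is_lproc (LPar E F) \<longleftrightarrow> is_lproc E \<and> is_lproc F"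
| "is_lproc (LBang v P) \<longleftrightarrow> is_proc P"
| "is_lproc (LOmg p) \<longleftrightarrow> False"
| "is_lproc (LObs p) \<longleftrightarrow> False"

primrec L :: "label \<Rightarrow> 'n pi \<Rightarrow> 'n lterm" where
  "L v Null = LNull"
| "L v (Inp x y P) = LInp x y v (L (fst v, snd v + 1) P)"
| "L v (Outp x y P) = LOutp x y v (L (fst v, snd v + 1) P)"
| "L v (Par P Q) = LPar (L (fst v @ [False], snd v) P) (L (fst v @ [True], snd v) Q)"
| "L v (Nu x P) = LNu x (L v P)"
| "L v (Bang P) = LBang v P"
| "L v (Omg p) = LOmg p"

primrec top_labels :: "'n lterm \<Rightarrow> label set" where
  "top_labels LNull = {}"
| "top_labels (LInp x y v E) = {v}"
| "top_labels (LOutp x y v E) = {v}"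
| "top_labels (LNu x E) = top_labels E"
| "top_labels (LPar E F) = top_labels E \<union> top_labels F"
| "top_labels (LBang v P) = {v}"
| "top_labels (LOmg p) = {}"
| "top_labels (LObs p) = {}"

inductive wfl :: "'n lterm \<Rightarrow> bool" where
  wfl_Null: "wfl LNull"
| wfl_Omg: "wfl (LOmg p)"
| wfl_Inp: "wfl (L v (Inp x y P))"
| wfl_Outp: "wfl (L v (Outp x y P))"
| wfl_Par: "wfl E \<Longrightarrow> wfl F \<Longrightarrow> unrelated (top_labels E) (top_labels F) \<Longrightarrow> wfl (LPar E F)"
| wfl_Nu: "wfl E \<Longrightarrow> wfl (LNu x E)"
| wfl_Bang: "wfl (LBang v P)"

definition Oe :: "'n lterm set" where
  "Oe = {E. wfl E}"

definition Pe :: "'n lterm set" where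
  "Pe = {E. wfl E \<and> is_lproc E}"

primrec Unl :: "'n lterm \<Rightarrow> 'n pi" where
  "Unl LNull = Null"
| "Unl (LInp x y v E) = Inp x y (Unl E)"
| "Unl (LOutp x y v E) = Outp x y (Unl E)"
| "Unl (LNu x E) = Nu x (Unl E)"
| "Unl (LPar E F) = Par (Unl E) (Unl F)"
| "Unl (LBang v P) = Bang P"
| "Unl (LOmg p) = Omg p"
| "Unl (LObs p) = p"

primrec lfn :: "'n lterm \<Rightarrow> 'n set" where
  "lfn LNull = {}"
| "lfn (LInp x y v E) = {x} \<union> (lfn E - {y})"
| "lfn (LOutp x y v E) = {x, y} \<union> lfn E"
| "lfn (LNu x E) = lfn E - {x}"
| "lfn (LPar E F) = lfn E \<union> lfn F"
| "lfn (LBang v P) = fn P"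
| "lfn (LOmg p) = fn p"
| "lfn (LObs p) = fn p"

primrec lsubst :: "('n \<Rightarrow> 'n) \<Rightarrow> 'n lterm \<Rightarrow> 'n lterm" where
  "lsubst \<sigma> LNull = LNull"
| "lsubst \<sigma> (LInp x y v E) =
     (let w = refresh y (\<sigma> ` (lfn E - {y})) in LInp (\<sigma> x) w v (lsubst (\<sigma>(y := w)) E))"
| "lsubst \<sigma> (LOutp x y v E) = LOutp (\<sigma> x) (\<sigma> y) v (lsubst \<sigma> E)"
| "lsubst \<sigma> (LNu y E) =
     (let w = refresh y (\<sigma> ` (lfn E - {y})) in LNu w (lsubst (\<sigma>(y := w)) E))"
| "lsubst \<sigma> (LPar E F) = LPar (lsubst \<sigma> E) (lsubst \<sigma> F)"
| "lsubst \<sigma> (LBang v P) = LBang v (subst \<sigma> P)"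
| "lsubst \<sigma> (LOmg p) = LOmg (subst \<sigma> p)"
| "lsubst \<sigma> (LObs p) = LObs (subst \<sigma> p)"

definition lsubst1 :: "'n \<Rightarrow> 'n \<Rightarrow> 'n lterm \<Rightarrow> 'n lterm" where
  "lsubst1 z y E = lsubst (id(y := z)) E"

inductive lalpha :: "'n lterm \<Rightarrow> 'n lterm \<Rightarrow> bool" where
  lalpha_refl: "lalpha E E"
| lalpha_sym: "lalpha E F \<Longrightarrow> lalpha F E"
| lalpha_trans: "lalpha E F \<Longrightarrow> lalpha F G \<Longrightarrow> lalpha E G"
| lalpha_Inp_rename: "z \<notin> lfn E \<Longrightarrow> lalpha (LInp x y v E) (LInp x z v (lsubst1 z y E))"
| lalpha_Nu_rename: "z \<notin> lfn E \<Longrightarrow> lalpha (LNu y E) (LNu z (lsubst1 z y E))"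
| lalpha_Inp: "lalpha E F \<Longrightarrow> lalpha (LInp x y v E) (LInp x y v F)"
| lalpha_Outp: "lalpha E F \<Longrightarrow> lalpha (LOutp x y v E) (LOutp x y v F)"
| lalpha_Nu: "lalpha E F \<Longrightarrow> lalpha (LNu x E) (LNu x F)"
| lalpha_Par: "lalpha E E' \<Longrightarrow> lalpha F F' \<Longrightarrow> lalpha (LPar E F) (LPar E' F')"
| lalpha_Bang: "alpha P Q \<Longrightarrow> lalpha (LBang v P) (LBang v Q)"
| lalpha_Omg: "alpha p q \<Longrightarrow> lalpha (LOmg p) (LOmg q)"
| lalpha_Obs: "alpha p q \<Longrightarrow> lalpha (LObs p) (LObs q)"

inductive lstep :: "'n lterm \<Rightarrow> 'n action \<Rightarrow> 'n lterm \<Rightarrow> bool" where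
  LInput: "lstep (LInp x y v E) (AIn x z) (lsubst1 z y E)"
| LOutput: "lstep (LOutp x y v E) (AOut x y) E"
| LOmega: "lstep (LOmg p) AOmg (LObs p)"
| LOpen: "lstep E (AOut x y) E' \<Longrightarrow> x \<noteq> y \<Longrightarrow> lstep (LNu y E) (ABOut x y) E'"
| LRes: "lstep E \<mu> E' \<Longrightarrow> y \<notin> act_n \<mu> \<Longrightarrow> lstep (LNu y E) \<mu> (LNu y E')"
| LPar1: "lstep E \<mu> E' \<Longrightarrow> act_bn \<mu> \<inter> lfn F = {} \<Longrightarrow> lstep (LPar E F) \<mu> (LPar E' F)"
| LPar2: "lstep F \<mu> F' \<Longrightarrow> act_bn \<mu> \<inter> lfn E = {} \<Longrightarrow> lstep (LPar E F) \<mu> (LPar E F')"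
| LCom1: "lstep E (AIn x y) E' \<Longrightarrow> lstep F (AOut x y) F' \<Longrightarrow>
    lstep (LPar E F) ATau (LPar E' F')"
| LCom2: "lstep E (AOut x y) E' \<Longrightarrow> lstep F (AIn x y) F' \<Longrightarrow>
    lstep (LPar E F) ATau (LPar E' F')"
| LClose1: "lstep E (AIn x y) E' \<Longrightarrow> lstep F (ABOut x y) F' \<Longrightarrow> y \<notin> lfn E \<Longrightarrow>
    lstep (LPar E F) ATau (LNu y (LPar E' F'))"
| LClose2: "lstep E (ABOut x y) E' \<Longrightarrow> lstep F (AIn x y) F' \<Longrightarrow> y \<notin> lfn F \<Longrightarrow>
    lstep (LPar E F) ATau (LNu y (LPar E' F'))"
| LRep: "step P \<mu> P' \<Longrightarrow>
    lstep (LBang (s, n) P) \<mu> (LPar (L (s @ [False], n + 1) P') (LBang (s @ [True], n + 1) P))"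
| LObserver: "step p \<mu> p' \<Longrightarrow> lstep (LObs p) \<mu> (LObs p')"
| LAlpha: "lalpha E F \<Longrightarrow> lstep F \<mu> F' \<Longrightarrow> lalpha F' E' \<Longrightarrow> lstep E \<mu> E'"

text \<open>
  In the rules for Close the term of the conclusion is \<open>(\<nu>y)(S | T)\<close>,
  not \<open>S | T\<close>: the binder created by the communication is already present.
\<close>

inductive live :: "label \<Rightarrow> 'n action \<Rightarrow> 'n lterm \<Rightarrow> bool" where
  live_Input: "live v (AIn x z) (LInp x y v S)"
| live_Output: "live v (AOut x z) (LOutp x z v S)"
| live_Res: "live v \<mu> S \<Longrightarrow> y \<notin> act_n \<mu> \<Longrightarrow> live v \<mu> (LNu y S)"
| live_Open: "live v (AOut x y) S \<Longrightarrow> x \<noteq> y \<Longrightarrow> live v (ABOut x y) (LNu y S)"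
| live_Rep: "step P \<mu> P' \<Longrightarrow> live v \<mu> (LBang v P)"
| live_Par1: "live v \<mu> S \<Longrightarrow> act_bn \<mu> \<inter> lfn T = {} \<Longrightarrow> live v \<mu> (LPar S T)"
| live_Par2: "live v \<mu> T \<Longrightarrow> act_bn \<mu> \<inter> lfn S = {} \<Longrightarrow> live v \<mu> (LPar S T)"
| live_Com1_in: "live v (AIn x y) S \<Longrightarrow> live w (AOut x y) T \<Longrightarrow> live v ATau (LPar S T)"
| live_Com1_out: "live v (AIn x y) S \<Longrightarrow> live w (AOut x y) T \<Longrightarrow> live w ATau (LPar S T)"
| live_Com2_in: "live v (AIn x y) T \<Longrightarrow> live w (AOut x y) S \<Longrightarrow> live v ATau (LPar S T)"
| live_Com2_out: "live v (AIn x y) T \<Longrightarrow> live w (AOut x y) S \<Longrightarrow> live w ATau (LPar S T)"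
| live_Close1_in: "live v (AIn x y) S \<Longrightarrow> live w (ABOut x y) T \<Longrightarrow> y \<notin> lfn S \<Longrightarrow>
    live v ATau (LNu y (LPar S T))"
| live_Close1_out: "live v (AIn x y) S \<Longrightarrow> live w (ABOut x y) T \<Longrightarrow> y \<notin> lfn S \<Longrightarrow>
    live w ATau (LNu y (LPar S T))"
| live_Close2_in: "live v (AIn x y) T \<Longrightarrow> live w (ABOut x y) S \<Longrightarrow> y \<notin> lfn T \<Longrightarrow>
    live v ATau (LNu y (LPar S T))"
| live_Close2_out: "live v (AIn x y) T \<Longrightarrow> live w (ABOut x y) S \<Longrightarrow> y \<notin> lfn T \<Longrightarrow>
    live w ATau (LNu y (LPar S T))"
| live_Alpha: "lalpha S T \<Longrightarrow> live v \<mu> T \<Longrightarrow> live v \<mu> S"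

definition Ll :: "'n lterm \<Rightarrow> label set" where
  "Ll S = {v. live v ATau S}"

text \<open>
  A computation is a sequence \<open>S\<close> together with the index \<open>N\<close> of its last
  state, where \<open>N = \<infinity>\<close> if it is infinite; the values of \<open>S\<close> beyond
  \<open>N\<close> are irrelevant.
\<close>

definition max_comp :: "(nat \<Rightarrow> 'n lterm) \<Rightarrow> enat \<Rightarrow> bool" where
  "max_comp S N \<longleftrightarrow>
     (\<forall>i. enat i < N \<longrightarrow> lstep (S i) ATau (S (Suc i))) \<and>
     (\<forall>i. enat i = N \<longrightarrow> (\<nexists>T. lstep (S i) ATau T))"

definition weak_fair :: "(nat \<Rightarrow> 'n lterm) \<Rightarrow> enat \<Rightarrow> bool" where
  "weak_fair S N \<longleftrightarrow>
     (\<forall>v i. enat i \<le> N \<longrightarrow> (\<exists>j\<ge>i. enat j \<le> N \<and> v \<notin> Ll (S j)))"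

definition strong_fair :: "(nat \<Rightarrow> 'n lterm) \<Rightarrow> enat \<Rightarrow> bool" where
  "strong_fair S N \<longleftrightarrow>
     (\<forall>v. \<exists>i. enat i \<le> N \<and> (\<forall>j\<ge>i. enat j \<le> N \<longrightarrow> v \<notin> Ll (S j)))"

definition wfmust :: "'n lterm \<Rightarrow> 'n lterm \<Rightarrow> bool" where
  "wfmust E \<rho> \<longleftrightarrow> (\<forall>S N. max_comp S N \<and> S 0 = LPar E \<rho> \<and> weak_fair S N \<longrightarrow>
     (\<exists>i. enat i \<le> N \<and> (\<exists>T. lstep (S i) AOmg T)))"

definition sfmust :: "'n lterm \<Rightarrow> 'n lterm \<Rightarrow> bool" where
  "sfmust E \<rho> \<longleftrightarrow> (\<forall>S N. max_comp S N \<and> S 0 = LPar E \<rho> \<and> strong_fair S N \<longrightarrow>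
     (\<exists>i. enat i \<le> N \<and> (\<exists>T. lstep (S i) AOmg T)))"

definition test_equiv :: "('n lterm \<Rightarrow> 'n lterm \<Rightarrow> bool) \<Rightarrow> 'n lterm \<Rightarrow> 'n lterm \<Rightarrow> bool" where
  "test_equiv sat E F \<longleftrightarrow> (\<forall>\<rho>\<in>Oe. sat E \<rho> \<longleftrightarrow> sat F \<rho>)"

end

theory Submission
  imports Defs
begin

text \<open>
  Let \<open>P = (\<nu>a)(\<bar>a c | a(a).\<bar>c c | a(a).0)\<close> choose internally whether to offer
  \<open>\<bar>c c\<close>, and let \<open>Q = (\<nu>a)(\<bar>a c | a(a).\<bar>c c | 0)\<close> offer it after one internal
  step. Then \<open>!P | Q\<close> and \<open>!P\<close> are bisimilar: since \<open>!P\<close> can always make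
  either choice, a state is determined up to bisimilarity by the number of its available outputs
  on \<open>c\<close>. Against the tester \<open>c(a).\<omega>\<close>, the label of \<open>Q\<close> in \<open>!P | Q\<close> stays
  live until \<open>Q\<close> moves, so fairness enforces an output on \<open>c\<close> and then success. Every
  step of \<open>!P\<close> renews its label, so the computation in which each copy of \<open>P\<close> makes the
  other choice is strong-fair, and it never succeeds.
\<close>

section \<open>An alpha-invariant interpretation\<close>

text \<open>
  A restricted name is interpreted by the depth \<open>Inr k\<close> of its binder, and the continuation of an
  input by a function of the received name. Alpha-equivalent terms get the same interpretation, so
  transitions can be inverted on it without the rule for alpha-conversion.
\<close>

datatype 'n sem =
    SNull
  | SInp "'n + nat" "'n + nat \<Rightarrow> 'n sem"
  | SOutp "'n + nat" "'n + nat" "'n sem"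
  | SPar "'n sem" "'n sem"
  | SNu nat "'n sem"
  | SBang "'n sem"
  | SOmg "'n sem"

primrec den :: "nat \<Rightarrow> ('n \<Rightarrow> 'n + nat) \<Rightarrow> 'n pi \<Rightarrow> 'n sem" where
  "den k \<sigma> Null = SNull"
| "den k \<sigma> (Inp x y P) = SInp (\<sigma> x) (\<lambda>d. den k (\<sigma>(y := d)) P)"
| "den k \<sigma> (Outp x y P) = SOutp (\<sigma> x) (\<sigma> y) (den k \<sigma> P)"
| "den k \<sigma> (Par P Q) = SPar (den k \<sigma> P) (den k \<sigma> Q)"
| "den k \<sigma> (Nu y P) = SNu k (den (Suc k) (\<sigma>(y := Inr k)) P)"
| "den k \<sigma> (Bang P) = SBang (den k \<sigma> P)"
| "den k \<sigma> (Omg P) = SOmg (den k \<sigma> P)"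

section \<open>Invariance under substitution and alpha-conversion\<close>

lemma finite_fn: "finite (fn P)"
  by (induction P) auto

lemma refresh_notin:
  fixes y :: "'n :: infinite"
  assumes "finite A"
  shows "refresh y A \<notin> A"
proof (cases "y \<in> A")
  case True
  have "\<exists>w. w \<notin> A"
    using assms ex_new_if_finite infinite_UNIV by blast
  from someI_ex[OF this] show ?thesis
    using True by (simp add: refresh_def)
qed (simp add: refresh_def)

lemma den_cong: "(\<And>x. x \<in> fn P \<Longrightarrow> \<sigma> x = \<tau> x) \<Longrightarrow> den k \<sigma> P = den k \<tau> P"
proof (induction P arbitrary: k \<sigma> \<tau>)
  case (Inp x y P)
  have "den k (\<sigma>(y := d)) P = den k (\<tau>(y := d)) P" for d
    using Inp.prems by (intro Inp.IH) auto
  then show ?case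
    using Inp.prems by simp
next
  case (Outp x y P)
  have "den k \<sigma> P = den k \<tau> P"
    using Outp.prems by (intro Outp.IH) simp
  then show ?case
    using Outp.prems by simp
next
  case (Par P Q)
  have "den k \<sigma> P = den k \<tau> P"
    using Par.prems by (intro Par.IH(1)) simp
  moreover have "den k \<sigma> Q = den k \<tau> Q"
    using Par.prems by (intro Par.IH(2)) simp
  ultimately show ?case by simp
next
  case (Nu y P)
  have "den (Suc k) (\<sigma>(y := Inr k)) P = den (Suc k) (\<tau>(y := Inr k)) P"
    using Nu.prems by (intro Nu.IH) auto
  then show ?case by simp
next
  case (Bang P)
  have "den k \<sigma> P = den k \<tau> P"
    using Bang.prems by (intro Bang.IH) simp
  then show ?case by simp
next
  case (Omg P)
  have "den k \<sigma> P = den k \<tau> P"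
    using Omg.prems by (intro Omg.IH) simp
  then show ?case by simp
qed simp

text \<open>The name chosen by \<open>refresh\<close> avoids the images of the other free names, so
  binding it in the environment disturbs none of them and the renaming is absorbed.\<close>

lemma den_subst:
  fixes P :: "'n :: infinite pi"
  shows "den k \<sigma> (subst \<tau> P) = den k (\<sigma> \<circ> \<tau>) P"
proof (induction P arbitrary: k \<sigma> \<tau>)
  case (Inp x y P)
  define w where "w = refresh y (\<tau> ` (fn P - {y}))"
  have "w \<notin> \<tau> ` (fn P - {y})"
    unfolding w_def by (simp add: refresh_notin finite_fn)
  then have "den k (\<sigma>(w := d) \<circ> \<tau>(y := w)) P = den k ((\<sigma> \<circ> \<tau>)(y := d)) P" for d
    by (intro den_cong) auto
  then have "(\<lambda>d. den k (\<sigma>(w := d)) (subst (\<tau>(y := w)) P)) = (\<lambda>d. den k ((\<sigma> \<circ> \<tau>)(y := d)) P)"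
    by (simp only: Inp.IH)
  then show ?case
    by (simp add: Let_def comp_def flip: w_def)
next
  case (Nu y P)
  define w where "w = refresh y (\<tau> ` (fn P - {y}))"
  have "w \<notin> \<tau> ` (fn P - {y})"
    unfolding w_def by (simp add: refresh_notin finite_fn)
  then have "den (Suc k) (\<sigma>(w := Inr k) \<circ> \<tau>(y := w)) P
      = den (Suc k) ((\<sigma> \<circ> \<tau>)(y := Inr k)) P"
    by (intro den_cong) auto
  then have "den (Suc k) (\<sigma>(w := Inr k)) (subst (\<tau>(y := w)) P) = den (Suc k) ((\<sigma> \<circ> \<tau>)(y := Inr k)) P"
    by (simp only: Nu.IH)
  then show ?case
    by (simp add: Let_def comp_def flip: w_def)
qed simp_all

lemma den_subst1:
  fixes P :: "'n :: infinite pi"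
  shows "den k \<sigma> (subst1 z y P) = den k (\<sigma>(y := \<sigma> z)) P"
  unfolding subst1_def den_subst by (rule den_cong) simp

lemma den_alpha:
  fixes P Q :: "'n :: infinite pi"
  shows "alpha P Q \<Longrightarrow> den k \<sigma> P = den k \<sigma> Q"
proof (induction arbitrary: k \<sigma> rule: alpha.induct)
  case (alpha_Inp_rename z P x y)
  \<comment> \<open>The renamed body is evaluated with both \<open>z\<close> and \<open>y\<close>
    sent to \<open>d\<close>; the binding of \<open>z\<close> is invisible because \<open>z\<close>
    is not free in \<open>P\<close>.\<close>
  have "den k (\<sigma>(y := d)) P = den k (\<sigma>(z := d, y := d)) P" for d
    using alpha_Inp_rename by (intro den_cong) auto
  then show ?case
    by (simp add: den_subst1)
next
  case (alpha_Nu_rename z P y)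
  have "den (Suc k) (\<sigma>(y := Inr k)) P = den (Suc k) (\<sigma>(z := Inr k, y := Inr k)) P"
    using alpha_Nu_rename by (intro den_cong) auto
  then show ?case
    by (simp add: den_subst1)
qed simp_all

text \<open>
  There are no rules for bound output. The relation is used only for terms in which the object of
  every output is a fixed free name; these cannot extrude a restricted name.
\<close>

inductive sstep :: "'n sem \<Rightarrow> ('n + nat) action \<Rightarrow> 'n sem \<Rightarrow> bool" where
  SInput: "sstep (SInp x f) (AIn x z) (f z)"
| SOutput: "sstep (SOutp x y D) (AOut x y) D"
| SOmega: "sstep (SOmg D) AOmg D"
| SRes: "sstep D \<mu> D' \<Longrightarrow> Inr k \<notin> act_n \<mu> \<Longrightarrow> sstep (SNu k D) \<mu> (SNu k D')"
| SPar1: "sstep D \<mu> D' \<Longrightarrow> sstep (SPar D C) \<mu> (SPar D' C)"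
| SPar2: "sstep C \<mu> C' \<Longrightarrow> sstep (SPar D C) \<mu> (SPar D C')"
| SCom1: "sstep D (AIn x y) D' \<Longrightarrow> sstep C (AOut x y) C' \<Longrightarrow> sstep (SPar D C) ATau (SPar D' C')"
| SCom2: "sstep D (AOut x y) D' \<Longrightarrow> sstep C (AIn x y) C' \<Longrightarrow> sstep (SPar D C) ATau (SPar D' C')"
| SRep: "sstep D \<mu> D' \<Longrightarrow> sstep (SBang D) \<mu> (SPar D' (SBang D))"

section \<open>Transitions without scope extrusion\<close>

primrec objs :: "'n \<Rightarrow> 'n sem \<Rightarrow> bool" where
  "objs c SNull \<longleftrightarrow> True"
| "objs c (SInp x f) \<longleftrightarrow> (\<forall>d. objs c (f d))"
| "objs c (SOutp x y D) \<longleftrightarrow> y = Inl c \<and> objs c D"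
| "objs c (SPar D C) \<longleftrightarrow> objs c D \<and> objs c C"
| "objs c (SNu k D) \<longleftrightarrow> objs c D"
| "objs c (SBang D) \<longleftrightarrow> objs c D"
| "objs c (SOmg D) \<longleftrightarrow> objs c D"

text \<open>Keeps level \<open>k\<close> out of the environment, so that the next binder,
  interpreted by \<open>Inr k\<close>, differs from every name already in scope.\<close>

definition below :: "nat \<Rightarrow> ('n \<Rightarrow> 'n + nat) \<Rightarrow> bool" where
  "below k \<sigma> \<longleftrightarrow> (\<forall>x j. \<sigma> x = Inr j \<longrightarrow> j < k)"

lemma below_Inl: "below k Inl"
  by (simp add: below_def)

lemma below_upd: "below k \<sigma> \<Longrightarrow> below (Suc k) (\<sigma>(y := Inr k))"
  by (auto simp: below_def less_Suc_eq)

lemma below_not_in_action: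
  assumes "below k \<sigma>"
  shows "Inr k \<notin> act_n (map_action \<sigma> \<mu>)"
proof -
  have "\<sigma> x \<noteq> Inr k" "Inr k \<noteq> \<sigma> x" for x
    using assms by (metis below_def less_irrefl)+
  then show ?thesis
    by (cases \<mu>) (auto simp: act_n_def)
qed

lemma map_action_upd: "y \<notin> act_n \<mu> \<Longrightarrow> map_action (\<sigma>(y := d)) \<mu> = map_action \<sigma> \<mu>"
  by (cases \<mu>) (auto simp: act_n_def)

text \<open>The three claims support each other. Open would output the restricted name, interpreted
  by \<open>Inr k\<close>, against the third claim; hence no bound output arises, and this rules out
  Close.\<close>

theorem sstep_of_step:
  fixes P P' :: "'n :: infinite pi"
  assumes "step P \<mu> P'" "below k \<sigma>" "objs c (den k \<sigma> P)"
  shows "sstep (den k \<sigma> P) (map_action \<sigma> \<mu>) (den k \<sigma> P') \<and> act_bn \<mu> = {} \<and>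
    (\<forall>x y. \<mu> = AOut x y \<longrightarrow> \<sigma> y = Inl c)"
  using assms
proof (induction arbitrary: k \<sigma> rule: step.induct)
  case (Input x y P z)
  then show ?case
    using SInput[of "\<sigma> x" "\<lambda>d. den k (\<sigma>(y := d)) P" "\<sigma> z"] by (simp add: den_subst1)
next
  case (Open P x y P')
  have "objs c (den (Suc k) (\<sigma>(y := Inr k)) P)"
    using Open.prems by simp
  from Open.IH[OF below_upd[OF Open.prems(1)] this] show ?case
    by auto
next
  case (Res P \<mu> P' y)
  have "objs c (den (Suc k) (\<sigma>(y := Inr k)) P)"
    using Res.prems by simp
  from Res.IH[OF below_upd[OF Res.prems(1)] this]
  have "sstep (den (Suc k) (\<sigma>(y := Inr k)) P) (map_action \<sigma> \<mu>) (den (Suc k) (\<sigma>(y := Inr k)) P')"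
    and *: "act_bn \<mu> = {}" "\<forall>x z. \<mu> = AOut x z \<longrightarrow> (\<sigma>(y := Inr k)) z = Inl c"
    using Res.hyps(2) by (simp_all add: map_action_upd del: fun_upd_apply)
  then have "sstep (den k \<sigma> (Nu y P)) (map_action \<sigma> \<mu>) (den k \<sigma> (Nu y P'))"
    using Res.prems(1) by (simp add: SRes below_not_in_action)
  with * Res.hyps(2) show ?case
    by (auto simp: act_n_def)
next
  case (Alpha P Q \<mu> Q' P')
  then show ?case
    using den_alpha[of P Q k \<sigma>] den_alpha[of Q' P' k \<sigma>, symmetric] by simp
qed (fastforce intro: sstep.intros)+

section \<open>Labelled terms\<close>

lemma lfn_Unl: "lfn E = fn (Unl E)"
  by (induction E) auto

lemma Unl_lsubst: "Unl (lsubst \<sigma> E) = subst \<sigma> (Unl E)"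
  by (induction E arbitrary: \<sigma>) (auto simp: Let_def lfn_Unl)

lemma Unl_lsubst1: "Unl (lsubst1 z y E) = subst1 z y (Unl E)"
  by (simp add: lsubst1_def subst1_def Unl_lsubst)

lemma Unl_L: "Unl (L v P) = P"
  by (induction P arbitrary: v) auto

lemma alpha_Unl: "lalpha E F \<Longrightarrow> alpha (Unl E) (Unl F)"
  by (induction rule: lalpha.induct) (auto simp: Unl_lsubst1 lfn_Unl intro: alpha.intros)

text \<open>Transfers labelled transitions to the unlabelled calculus, so that
  \<open>sstep_of_step\<close> constrains them too; in \<open>LRep\<close> the new labels vanish by
  \<open>Unl_L\<close>.\<close>

theorem step_Unl: "lstep E \<mu> E' \<Longrightarrow> step (Unl E) \<mu> (Unl E')"
proof (induction rule: lstep.induct)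
  case (LAlpha E F \<mu> F' E')
  then show ?case
    by (meson Alpha alpha_Unl)
qed (auto simp: Unl_lsubst1 Unl_L lfn_Unl intro: step.intros)

text \<open>The premises of each \<open>live\<close> rule mirror those of a transition rule. Hence a
  term whose interpretation cannot move has no live label.\<close>

theorem sstep_of_live:
  fixes S :: "'n :: infinite lterm"
  assumes "live v \<mu> S" "below k \<sigma>" "objs c (den k \<sigma> (Unl S))"
  shows "(\<exists>D. sstep (den k \<sigma> (Unl S)) (map_action \<sigma> \<mu>) D) \<and> act_bn \<mu> = {} \<and>
    (\<forall>x y. \<mu> = AOut x y \<longrightarrow> \<sigma> y = Inl c)"
  using assms
proof (induction arbitrary: k \<sigma> rule: live.induct)
  case (live_Res v \<mu> S y)
  have "objs c (den (Suc k) (\<sigma>(y := Inr k)) (Unl S))"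
    using live_Res.prems by simp
  from live_Res.IH[OF below_upd[OF live_Res.prems(1)] this] obtain D
    where "sstep (den (Suc k) (\<sigma>(y := Inr k)) (Unl S)) (map_action \<sigma> \<mu>) D" and
      *: "act_bn \<mu> = {}" "\<forall>x z. \<mu> = AOut x z \<longrightarrow> (\<sigma>(y := Inr k)) z = Inl c"
    using live_Res.hyps(2) by (auto simp add: map_action_upd simp del: fun_upd_apply)
  then have "sstep (den k \<sigma> (Unl (LNu y S))) (map_action \<sigma> \<mu>) (SNu k D)"
    using live_Res.prems(1) by (simp add: SRes below_not_in_action)
  with * live_Res.hyps(2) show ?case
    by (auto simp: act_n_def)
next
  case (live_Open v x y S)
  have "objs c (den (Suc k) (\<sigma>(y := Inr k)) (Unl S))"
    using live_Open.prems by simp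
  from live_Open.IH[OF below_upd[OF live_Open.prems(1)] this] show ?case
    by auto
next
  case (live_Rep P \<mu> P' v)
  then have "sstep (den k \<sigma> P) (map_action \<sigma> \<mu>) (den k \<sigma> P') \<and> act_bn \<mu> = {} \<and>
    (\<forall>x y. \<mu> = AOut x y \<longrightarrow> \<sigma> y = Inl c)"
    by (intro sstep_of_step) auto
  then show ?case
    by (auto intro: sstep.intros)
next
  case (live_Close1_in v x y S w T)
  \<comment> \<open>The component \<open>T\<close> lies below the binder \<open>y\<close>, so it is
    interpreted one level deeper. Its live bound output contradicts the second claim.\<close>
  have "objs c (den (Suc k) (\<sigma>(y := Inr k)) (Unl T))"
    using live_Close1_in.prems by simp
  from live_Close1_in.IH(2)[OF below_upd[OF live_Close1_in.prems(1)] this] show ?case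
    by auto
next
  case (live_Close1_out v x y S w T)
  have "objs c (den (Suc k) (\<sigma>(y := Inr k)) (Unl T))"
    using live_Close1_out.prems by simp
  from live_Close1_out.IH(2)[OF below_upd[OF live_Close1_out.prems(1)] this] show ?case
    by auto
next
  case (live_Close2_in v x y T w S)
  have "objs c (den (Suc k) (\<sigma>(y := Inr k)) (Unl S))"
    using live_Close2_in.prems by simp
  from live_Close2_in.IH(2)[OF below_upd[OF live_Close2_in.prems(1)] this] show ?case
    by auto
next
  case (live_Close2_out v x y T w S)
  have "objs c (den (Suc k) (\<sigma>(y := Inr k)) (Unl S))"
    using live_Close2_out.prems by simp
  from live_Close2_out.IH(2)[OF below_upd[OF live_Close2_out.prems(1)] this] show ?case
    by auto
next
  case (live_Alpha S T v \<mu>)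
  then show ?case
    using den_alpha[OF alpha_Unl[OF live_Alpha.hyps(1)], of k \<sigma>] by simp
qed (fastforce intro: sstep.intros)+

section \<open>Preservation of the process grammar\<close>

lemma is_proc_subst: "is_proc (subst \<sigma> P) = is_proc P"
  by (induction P arbitrary: \<sigma>) (auto simp: Let_def)

lemma is_proc_alpha: "alpha P Q \<Longrightarrow> is_proc P = is_proc Q"
  by (induction rule: alpha.induct) (auto simp: subst1_def is_proc_subst)

lemma is_proc_step: "step P \<mu> P' \<Longrightarrow> is_proc P \<Longrightarrow> is_proc P'"
proof (induction rule: step.induct)
  case (Alpha P Q \<mu> Q' P')
  then show ?case
    using is_proc_alpha by blast
qed (auto simp: subst1_def is_proc_subst)

lemma is_lproc_lsubst: "is_lproc (lsubst \<sigma> E) = is_lproc E"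
  by (induction E arbitrary: \<sigma>) (auto simp: Let_def is_proc_subst)

lemma is_lproc_lalpha: "lalpha E F \<Longrightarrow> is_lproc E = is_lproc F"
proof (induction rule: lalpha.induct)
  case (lalpha_Bang P Q v)
  then show ?case
    using is_proc_alpha by auto
qed (auto simp: lsubst1_def is_lproc_lsubst)

lemma is_lproc_L: "is_lproc (L v P) = is_proc P"
  by (induction P arbitrary: v) auto

lemma is_lproc_lstep: "lstep E \<mu> E' \<Longrightarrow> is_lproc E \<Longrightarrow> is_lproc E'"
proof (induction rule: lstep.induct)
  case (LRep P \<mu> P' s n)
  then show ?case
    using is_proc_step by (auto simp: is_lproc_L)
next
  case (LAlpha E F \<mu> F' E')
  then show ?case
    using is_lproc_lalpha by blast
qed (auto simp: lsubst1_def is_lproc_lsubst)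

section \<open>Inversion for parallel composition and replication\<close>

lemma lalpha_LPar_aux:
  "lalpha S T \<Longrightarrow>
    (\<forall>E F. S = LPar E F \<longrightarrow> (\<exists>E' F'. T = LPar E' F' \<and> lalpha E E' \<and> lalpha F F')) \<and>
    (\<forall>E F. T = LPar E F \<longrightarrow> (\<exists>E' F'. S = LPar E' F' \<and> lalpha E E' \<and> lalpha F F'))"
\<comment> \<open>Both directions in one statement let the induction pass through the symmetry
  rule.\<close>
proof (induction rule: lalpha.induct)
  case (lalpha_trans E F G)
  show ?case
    using lalpha_trans.IH lalpha.lalpha_trans by metis
next
  case (lalpha_Par E E' F F')
  then show ?case
    by (simp add: lalpha.lalpha_sym[of E E'] lalpha.lalpha_sym[of F F'])
qed (auto intro: lalpha_refl)

lemma lalpha_LParE: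
  assumes "lalpha (LPar E F) T"
  obtains E' F' where "T = LPar E' F'" "lalpha E E'" "lalpha F F'"
  using lalpha_LPar_aux[OF assms] by auto

lemma lalpha_LBang:
  "lalpha S T \<Longrightarrow> (\<exists>P. S = LBang v P) \<longleftrightarrow> (\<exists>P. T = LBang v P)"
  by (induction rule: lalpha.induct) auto

text \<open>Because of \<open>LAlpha\<close>, an idle component is known only up to
  alpha-equivalence. The Close rules are merged into \<open>bound\<close>, since bound outputs are
  refuted wherever the inversion is applied.\<close>

lemma lstep_LParE:
  assumes "lstep (LPar E F) \<mu> S"
  obtains
    (left) E' F' where "S = LPar E' F'" "lstep E \<mu> E'" "lalpha F F'"
  | (right) E' F' where "S = LPar E' F'" "lalpha E E'" "lstep F \<mu> F'"
  | (com1) x y E' F' where "S = LPar E' F'" "lstep E (AIn x y) E'" "lstep F (AOut x y) F'"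
  | (com2) x y E' F' where "S = LPar E' F'" "lstep E (AOut x y) E'" "lstep F (AIn x y) F'"
  | (bound) x y G where "lstep E (ABOut x y) G \<or> lstep F (ABOut x y) G"
proof -
  have "(\<exists>E' F'. S = LPar E' F' \<and> lstep E \<mu> E' \<and> lalpha F F') \<or>
    (\<exists>E' F'. S = LPar E' F' \<and> lalpha E E' \<and> lstep F \<mu> F') \<or>
    (\<exists>x y E' F'. S = LPar E' F' \<and> lstep E (AIn x y) E' \<and> lstep F (AOut x y) F') \<or>
    (\<exists>x y E' F'. S = LPar E' F' \<and> lstep E (AOut x y) E' \<and> lstep F (AIn x y) F') \<or>
    (\<exists>x y G. lstep E (ABOut x y) G \<or> lstep F (ABOut x y) G)"
    using assms
  proof (induction "LPar E F" \<mu> S arbitrary: E F rule: lstep.induct)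
    case (LAlpha G \<mu> S T)
    from LAlpha.hyps(1) obtain E1 F1 where G: "G = LPar E1 F1" "lalpha E E1" "lalpha F F1"
      by (rule lalpha_LParE)
    have E: "lstep E \<nu> E'" if "lstep E1 \<nu> E1'" "lalpha E1' E'" for \<nu> E1' E'
      using G that lstep.LAlpha by blast
    have F: "lstep F \<nu> F'" if "lstep F1 \<nu> F1'" "lalpha F1' F'" for \<nu> F1' F'
      using G that lstep.LAlpha by blast
    have T: "\<exists>E2 F2. T = LPar E2 F2 \<and> lalpha E' E2 \<and> lalpha F' F2" if "S = LPar E' F'" for E' F'
      using LAlpha.hyps(4) that by (auto elim: lalpha_LParE)
    from LAlpha.hyps(3)[OF G(1)] show ?case
    proof (elim disjE exE conjE)
      fix E' F' assume *: "S = LPar E' F'" "lstep E1 \<mu> E'" "lalpha F1 F'"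
      with T obtain E2 F2 where "T = LPar E2 F2" "lalpha E' E2" "lalpha F' F2"
        by blast
      moreover from this * G have "lstep E \<mu> E2" "lalpha F F2"
        by (blast intro: E lalpha_trans)+
      ultimately show ?thesis by simp
    next
      fix E' F' assume *: "S = LPar E' F'" "lalpha E1 E'" "lstep F1 \<mu> F'"
      with T obtain E2 F2 where "T = LPar E2 F2" "lalpha E' E2" "lalpha F' F2"
        by blast
      moreover from this * G have "lstep F \<mu> F2" "lalpha E E2"
        by (blast intro: F lalpha_trans)+
      ultimately show ?thesis by simp
    next
      fix x y E' F'
      assume *: "S = LPar E' F'" "lstep E1 (AIn x y) E'" "lstep F1 (AOut x y) F'"
      with T obtain E2 F2 where "T = LPar E2 F2" "lalpha E' E2" "lalpha F' F2"
        by blast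
      moreover from this * have "lstep E (AIn x y) E2" "lstep F (AOut x y) F2"
        by (blast intro: E F)+
      ultimately show ?thesis by blast
    next
      fix x y E' F'
      assume *: "S = LPar E' F'" "lstep E1 (AOut x y) E'" "lstep F1 (AIn x y) F'"
      with T obtain E2 F2 where "T = LPar E2 F2" "lalpha E' E2" "lalpha F' F2"
        by blast
      moreover from this * have "lstep E (AOut x y) E2" "lstep F (AIn x y) F2"
        by (blast intro: E F)+
      ultimately show ?thesis by blast
    next
      fix x y G' assume "lstep E1 (ABOut x y) G'"
      then have "lstep E (ABOut x y) G'"
        by (rule E[OF _ lalpha_refl])
      then show ?thesis by blast
    next
      fix x y G' assume "lstep F1 (ABOut x y) G'"
      then have "lstep F (ABOut x y) G'"
        by (rule F[OF _ lalpha_refl])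
      then show ?thesis by blast
    qed
  qed (auto intro: lalpha_refl)
  then show ?thesis
    using that by blast
qed

text \<open>The \<open>live\<close> rules for Close concern terms headed by \<open>LNu\<close>, so
  no bound case arises. The communication cases record only that matching actions are live, which is
  what later arguments refute.\<close>

lemma live_LParE:
  assumes "live v \<mu> (LPar S T)"
  obtains
    (left) "live v \<mu> S"
  | (right) "live v \<mu> T"
  | (com1) w w' x y where "live w (AIn x y) S" "live w' (AOut x y) T"
  | (com2) w w' x y where "live w (AOut x y) S" "live w' (AIn x y) T"
proof -
  have "live v \<mu> S \<or> live v \<mu> T \<or>
    (\<exists>w w' x y. live w (AIn x y) S \<and> live w' (AOut x y) T) \<or>
    (\<exists>w w' x y. live w (AOut x y) S \<and> live w' (AIn x y) T)"
    using assms
  proof (induction v \<mu> "LPar S T" arbitrary: S T rule: live.induct)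
    case (live_Alpha G v \<mu>)
    then obtain S' T' where G: "G = LPar S' T'" "lalpha S S'" "lalpha T T'"
      by (blast elim: lalpha_LParE)
    then show ?case
      using live_Alpha.hyps(3)[OF G(1)] live.live_Alpha by blast
  qed auto
  then show ?thesis
    using that by blast
qed

lemma live_LBang: "live v \<mu> (LBang w P) \<Longrightarrow> v = w"
proof (induction v \<mu> "LBang w P" arbitrary: P rule: live.induct)
  case (live_Alpha T v \<mu>)
  from lalpha_LBang[OF live_Alpha.hyps(1), of w] obtain P' where "T = LBang w P'"
    by auto
  then show ?case
    by (rule live_Alpha.hyps(3))
qed auto

lemma strong_imp_weak_fair:
  assumes "strong_fair S N"
  shows "weak_fair S N"
  unfolding weak_fair_def
proof (intro allI impI)
  fix v i
  assume "enat i \<le> N"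
  from assms obtain k where "enat k \<le> N" "\<forall>j\<ge>k. enat j \<le> N \<longrightarrow> v \<notin> Ll (S j)"
    unfolding strong_fair_def by blast
  with \<open>enat i \<le> N\<close> show "\<exists>j\<ge>i. enat j \<le> N \<and> v \<notin> Ll (S j)"
    by (intro exI[of _ "max i k"]) (simp add: max_def)
qed

section \<open>The two processes\<close>

inductive_cases sstep_elims:
  "sstep SNull \<mu> D'" "sstep (SInp x f) \<mu> D'" "sstep (SOutp x y D) \<mu> D'" "sstep (SOmg D) \<mu> D'"
  "sstep (SPar D C) \<mu> D'" "sstep (SNu k D) \<mu> D'" "sstep (SBang D) \<mu> D'"

abbreviation msg :: "'n \<Rightarrow> 'n sem" where
  "msg c \<equiv> SOutp (Inl c) (Inl c) SNull"

abbreviation cell :: "'n sem \<Rightarrow> 'n sem \<Rightarrow> 'n sem \<Rightarrow> 'n sem" where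
  "cell X Y Z \<equiv> SNu 0 (SPar (SPar X Y) Z)"

abbreviation trigger :: "'n \<Rightarrow> 'n sem" where
  "trigger c \<equiv> SOutp (Inr 0) (Inl c) SNull"

text \<open>A constant function, since the continuations of both inputs on the restricted name
  ignore the name received.\<close>

abbreviation guard :: "'n sem \<Rightarrow> 'n sem" where
  "guard D \<equiv> SInp (Inr 0) (\<lambda>_. D)"

abbreviation choice :: "'n \<Rightarrow> 'n sem" where
  "choice c \<equiv> cell (trigger c) (guard (msg c)) (guard SNull)"

text \<open>The number counts the outputs on \<open>c\<close> that are available at once.\<close>

inductive state :: "'n \<Rightarrow> 'n sem \<Rightarrow> nat \<Rightarrow> bool" for c where
  state_cell: "X \<in> {SNull, trigger c} \<Longrightarrow> Y \<in> {SNull, guard (msg c)} \<Longrightarrow>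
    Z \<in> {SNull, guard SNull} \<Longrightarrow> state c (cell X Y Z) 0"
| state_msg: "X \<in> {SNull, trigger c} \<Longrightarrow> Z \<in> {SNull, guard SNull} \<Longrightarrow>
    state c (cell X (msg c) Z) 1"
| state_bang: "state c (SBang (choice c)) 0"
| state_par: "state c D m \<Longrightarrow> state c C n \<Longrightarrow> state c (SPar D C) (m + n)"

inductive_cases state_parE: "state c (SPar D C) n"
inductive_cases state_NuE: "state c (SNu k D) n"
inductive_cases state_BangE: "state c (SBang D) n"
inductive_cases state_others:
  "state c SNull n" "state c (SInp x f) n" "state c (SOutp x y D) n" "state c (SOmg D) n"

lemma state_objs: "state c D n \<Longrightarrow> objs c D"
  by (induction rule: state.induct) auto

text \<open>Offers on \<open>Inr 0\<close> are blocked by the restriction, so a step is a meeting of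
  the trigger with a guard: the one in the second slot raises the count to 1, the one in the third
  keeps it at 0.\<close>

lemma cell_sstep:
  assumes "X \<in> {SNull, trigger c}" "Y \<in> {SNull, guard (msg c)}" "Z \<in> {SNull, guard SNull}"
    and "sstep (cell X Y Z) \<mu> D"
  shows "\<mu> = ATau \<and> (state c D 0 \<or> state c D 1)"
  using assms by (auto elim!: sstep_elims simp: act_n_def intro: state_cell state_msg[simplified])

lemma msg_sstep:
  assumes "X \<in> {SNull, trigger c}" "Z \<in> {SNull, guard SNull}"
    and "sstep (cell X (msg c) Z) \<mu> D"
  shows "\<mu> = ATau \<and> state c D 1 \<or> \<mu> = AOut (Inl c) (Inl c) \<and> state c D 0"
  using assms by (auto elim!: sstep_elims simp: act_n_def intro: state_cell state_msg[simplified])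

lemma forced_sstep:
  assumes "sstep (cell (trigger c) (guard (msg c)) SNull) \<mu> D"
  shows "D = cell SNull (msg c) SNull"
  using assms by (auto elim!: sstep_elims simp: act_n_def)

lemma dead_sstep: "\<not> sstep (cell SNull (guard D) SNull) \<mu> D'"
  by (auto elim!: sstep_elims simp: act_n_def)

text \<open>No state performs an input, so parallel components never communicate and each step
  changes the count of a single component.\<close>

lemma state_sstep:
  assumes "state c D n" "sstep D \<mu> D'"
  shows "\<mu> = ATau \<and> (state c D' n \<or> state c D' (Suc n)) \<or>
    \<mu> = AOut (Inl c) (Inl c) \<and> (\<exists>m. n = Suc m \<and> state c D' m)"
  using assms
proof (induction arbitrary: \<mu> D' rule: state.induct)
  case (state_cell X Y Z)
  then show ?case
    using cell_sstep[of X c Y Z \<mu> D'] by auto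
next
  case (state_msg X Z)
  then show ?case
    using msg_sstep[of X c Z \<mu> D'] by auto
next
  case state_bang
  then obtain C where "D' = SPar C (SBang (choice c))" "sstep (choice c) \<mu> C"
    by (auto elim: sstep_elims(7))
  moreover have "\<mu> = ATau \<and> (state c C 0 \<or> state c C 1)"
    using calculation(2) by (intro cell_sstep) auto
  ultimately show ?case
    using state_par[OF _ state.state_bang[of c], of C 0] state_par[OF _ state.state_bang[of c], of C 1]
    by auto
next
  case (state_par D m C n)
  from state_par.prems show ?case
  proof (elim sstep_elims(5))
    fix D1 assume D1: "D' = SPar D1 C" "sstep D \<mu> D1"
    have "state c D' (i + n)" if "state c D1 i" for i
      using that state_par.hyps(2) unfolding D1(1) by (rule state.state_par)
    with state_par.IH(1)[OF D1(2)] show ?thesis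
      by fastforce
  next
    fix C1 assume C1: "D' = SPar D C1" "sstep C \<mu> C1"
    have "state c D' (m + j)" if "state c C1 j" for j
      unfolding C1(1) using state_par.hyps(1) that by (rule state.state_par)
    with state_par.IH(2)[OF C1(2)] show ?thesis
      by fastforce
  next
    fix x y D1 assume "sstep D (AIn x y) D1"
    with state_par.IH(1) show ?thesis by blast
  next
    fix x y C1 assume "sstep C (AIn x y) C1"
    with state_par.IH(2) show ?thesis by blast
  qed
qed

text \<open>A replicated choice outside every restriction and prefix: it survives each transition
  and lets a state take either kind of internal step.\<close>

primrec replicates :: "'n \<Rightarrow> 'n sem \<Rightarrow> bool" where
  "replicates c SNull \<longleftrightarrow> False"
| "replicates c (SInp x f) \<longleftrightarrow> False"
| "replicates c (SOutp x y D) \<longleftrightarrow> False"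
| "replicates c (SPar D C) \<longleftrightarrow> replicates c D \<or> replicates c C"
| "replicates c (SNu k D) \<longleftrightarrow> False"
| "replicates c (SBang D) \<longleftrightarrow> D = choice c"
| "replicates c (SOmg D) \<longleftrightarrow> False"

lemma replicates_sstep: "sstep D \<mu> D' \<Longrightarrow> replicates c D \<Longrightarrow> replicates c D'"
  by (induction rule: sstep.induct) auto

section \<open>Realizing moves of states by transitions of the calculus\<close>

lemma den_eq:
  "den k \<sigma> P = SNull \<longleftrightarrow> P = Null"
  "den k \<sigma> P = SInp d f \<longleftrightarrow> (\<exists>x y Q. P = Inp x y Q \<and> \<sigma> x = d \<and> (\<lambda>e. den k (\<sigma>(y := e)) Q) = f)"
  "den k \<sigma> P = SOutp d e D \<longleftrightarrow> (\<exists>x y Q. P = Outp x y Q \<and> \<sigma> x = d \<and> \<sigma> y = e \<and> den k \<sigma> Q = D)"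
  "den k \<sigma> P = SPar D C \<longleftrightarrow> (\<exists>Q R. P = Par Q R \<and> den k \<sigma> Q = D \<and> den k \<sigma> R = C)"
  "den k \<sigma> P = SNu j D \<longleftrightarrow> (\<exists>y Q. P = Nu y Q \<and> j = k \<and> den (Suc k) (\<sigma>(y := Inr k)) Q = D)"
  "den k \<sigma> P = SBang D \<longleftrightarrow> (\<exists>Q. P = Bang Q \<and> den k \<sigma> Q = D)"
  "den k \<sigma> P = SOmg D \<longleftrightarrow> (\<exists>Q. P = Omg Q \<and> den k \<sigma> Q = D)"
  by (cases P; auto)+

text \<open>The translation so far runs from \<open>step\<close> to \<open>sstep\<close>. Answering
  a move requires an actual transition, so the syntax of \<open>P\<close> is read back from its
  interpretation, with the input continuations known only as functions.\<close>

lemma choice_step: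
  fixes P :: "'n :: infinite pi"
  assumes "den 0 Inl P = choice c"
  shows "\<exists>P'. step P ATau P' \<and> den 0 Inl P' = cell SNull (msg c) (guard SNull)"
    and "\<exists>P'. step P ATau P' \<and> den 0 Inl P' = cell SNull (guard (msg c)) SNull"
proof -
  obtain a y z Q R where P: "P = Nu a (Par (Par (Outp a c Null) (Inp a y Q)) (Inp a z R))"
    and ac: "a \<noteq> c"
    and Q: "(\<lambda>e. den (Suc 0) ((Inl(a := Inr 0))(y := e)) Q) = (\<lambda>_. msg c)"
    and R: "(\<lambda>e. den (Suc 0) ((Inl(a := Inr 0))(z := e)) R) = (\<lambda>_. SNull)"
    using assms by (auto simp: den_eq split: if_splits)
  have "step P ATau (Nu a (Par (Par Null (subst1 c y Q)) (Inp a z R)))"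
    unfolding P by (intro Res Par1 Com2[of _ a c] Input Output) (auto simp: act_n_def)
  moreover have "den 0 Inl (Nu a (Par (Par Null (subst1 c y Q)) (Inp a z R)))
      = cell SNull (msg c) (guard SNull)"
    \<comment> \<open>The name received is \<open>c\<close>; evaluating the equality of functions at
      \<open>Inl c\<close> identifies the continuation after substitution.\<close>
    using fun_cong[OF Q, of "Inl c"] R ac by (simp add: den_subst1)
  ultimately show "\<exists>P'. step P ATau P' \<and> den 0 Inl P' = cell SNull (msg c) (guard SNull)"
    by blast
  have "step P ATau (Nu a (Par (Par Null (Inp a y Q)) (subst1 c z R)))"
    unfolding P by (intro Res Com2[of _ a c] Par1 Input Output) (auto simp: act_n_def)
  moreover have "den 0 Inl (Nu a (Par (Par Null (Inp a y Q)) (subst1 c z R)))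
      = cell SNull (guard (msg c)) SNull"
    using fun_cong[OF R, of "Inl c"] Q ac by (simp add: den_subst1)
  ultimately show "\<exists>P'. step P ATau P' \<and> den 0 Inl P' = cell SNull (guard (msg c)) SNull"
    by blast
qed

text \<open>The choice made by a new copy decides whether the count stays or rises, whatever the
  rest of the state is.\<close>

lemma replicates_step:
  fixes P :: "'n :: infinite pi"
  assumes "state c (den 0 Inl P) n" "replicates c (den 0 Inl P)" "m = n \<or> m = Suc n"
  shows "\<exists>P'. step P ATau P' \<and> state c (den 0 Inl P') m"
  using assms
proof (induction P arbitrary: n m)
  case (Par P Q)
  then obtain i j where n: "n = i + j" and i: "state c (den 0 Inl P) i" and j: "state c (den 0 Inl Q) j"
    by (auto elim: state_parE)
  from Par.prems(2) consider "replicates c (den 0 Inl P)" | "replicates c (den 0 Inl Q)"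
    by auto
  then show ?case
  proof cases
    case 1
    \<comment> \<open>The other component keeps contributing \<open>j\<close>; since
      \<open>m\<close> is at least \<open>n = i + j\<close>, the subtraction loses nothing.\<close>
    with Par.IH(1)[OF i, of "m - j"] Par.prems(3) n obtain P'
      where "step P ATau P'" "state c (den 0 Inl P') (m - j)"
      by auto
    then have "step (Par P Q) ATau (Par P' Q)" "state c (den 0 Inl (Par P' Q)) (m - j + j)"
      using j by (auto intro: Par1 state_par)
    then show ?thesis
      using Par.prems(3) n by auto
  next
    case 2
    with Par.IH(2)[OF j, of "m - i"] Par.prems(3) n obtain Q'
      where "step Q ATau Q'" "state c (den 0 Inl Q') (m - i)"
      by auto
    then have "step (Par P Q) ATau (Par P Q')" "state c (den 0 Inl (Par P Q')) (i + (m - i))"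
      using i state_par[of c "den 0 Inl P" i "den 0 Inl Q'" "m - i"] by (auto intro: Par2)
    then show ?thesis
      using Par.prems(3) n by auto
  qed
next
  case (Bang P)
  then have P: "den 0 Inl P = choice c" and [simp]: "n = 0"
    by (auto elim: state_BangE)
  have "\<exists>P'. step P ATau P' \<and> state c (den 0 Inl P') m"
    using choice_step[OF P] Bang.prems(3) state_cell[of SNull c "guard (msg c)" SNull]
      state_msg[of SNull c "guard SNull"]
    by fastforce
  then obtain P' where "step P ATau P'" "state c (den 0 Inl P') m"
    by blast
  then have "step (Bang P) ATau (Par P' (Bang P))"
    and "state c (den 0 Inl (Par P' (Bang P))) (m + 0)"
    using state_par[OF _ state_bang[of c]] P by (auto intro: Rep)
  then show ?case by auto
qed simp_all

text \<open>A positive count comes from some cell holding a message, and its restricted name differs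
  from \<open>c\<close>, so the output passes the restriction.\<close>

lemma state_output:
  fixes P :: "'n :: infinite pi"
  assumes "state c (den 0 Inl P) (Suc n)"
  shows "\<exists>P'. step P (AOut c c) P' \<and> state c (den 0 Inl P') n"
  using assms
proof (induction P arbitrary: n)
  case (Par P Q)
  then obtain i j where n: "Suc n = i + j" and i: "state c (den 0 Inl P) i" and j: "state c (den 0 Inl Q) j"
    by (auto elim: state_parE)
  show ?case
  proof (cases i)
    case 0
    with n Par.IH(2)[of n] j obtain Q' where "step Q (AOut c c) Q'" "state c (den 0 Inl Q') n"
      by auto
    then show ?thesis
      using state_par[OF i, of "den 0 Inl Q'" n] 0 by (auto intro!: exI Par2)
  next
    case (Suc l)
    with Par.IH(1)[of l] i obtain P' where "step P (AOut c c) P'" "state c (den 0 Inl P') l"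
      by auto
    then show ?thesis
      using state_par[OF _ j, of "den 0 Inl P'" l] Suc n by (auto intro!: exI Par1)
  qed
next
  case (Nu a P)
  then obtain X Z where XZ: "X \<in> {SNull, trigger c}" "Z \<in> {SNull, guard SNull}"
    and P: "den (Suc 0) (Inl(a := Inr 0)) P = SPar (SPar X (msg c)) Z" and [simp]: "n = 0"
    by (auto elim!: state_NuE)
  then obtain Q R where PQR: "P = Par (Par Q (Outp c c Null)) R" and ac: "a \<noteq> c"
    and "den (Suc 0) (Inl(a := Inr 0)) Q = X" "den (Suc 0) (Inl(a := Inr 0)) R = Z"
    by (auto simp: den_eq split: if_splits)
  have "step (Nu a P) (AOut c c) (Nu a (Par (Par Q Null) R))"
    unfolding PQR using ac by (intro Res Par1 Par2 Output) (auto simp: act_n_def)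
  moreover have "den 0 Inl (Nu a (Par (Par Q Null) R)) = cell X SNull Z"
    using \<open>den _ _ Q = X\<close> \<open>den _ _ R = Z\<close> by simp
  ultimately show ?case
    using XZ state_cell[of X c SNull Z] by auto
qed (auto elim!: state_others state_BangE)

text \<open>The candidate bisimulation. The two terms may differ in shape and share only the count;
  their replicated choices make up for the difference.\<close>

definition family :: "'n \<Rightarrow> 'n pi \<Rightarrow> 'n pi \<Rightarrow> bool" where
  "family c P Q \<longleftrightarrow> is_proc P \<and> is_proc Q \<and>
    replicates c (den 0 Inl P) \<and> replicates c (den 0 Inl Q) \<and>
    (\<exists>n. state c (den 0 Inl P) n \<and> state c (den 0 Inl Q) n)"

lemma family_step:
  fixes P Q :: "'n :: infinite pi"
  assumes "family c P Q" "step P \<mu> P'"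
  shows "\<exists>Q'. step Q \<mu> Q' \<and> family c P' Q'"
proof -
  obtain n where n: "state c (den 0 Inl P) n" "state c (den 0 Inl Q) n"
    and Q: "replicates c (den 0 Inl Q)" "is_proc Q"
    using assms by (auto simp: family_def)
  have s: "sstep (den 0 Inl P) (map_action Inl \<mu>) (den 0 Inl P')"
    using sstep_of_step[OF assms(2) below_Inl state_objs[OF n(1)]] by simp
  have P': "replicates c (den 0 Inl P')" "is_proc P'"
    using assms s replicates_sstep is_proc_step by (auto simp: family_def)
  from state_sstep[OF n(1) s] have "\<exists>Q'. step Q \<mu> Q' \<and> (\<exists>m. state c (den 0 Inl P') m \<and> state c (den 0 Inl Q') m)"
  proof (elim disjE conjE exE)
    assume "map_action Inl \<mu> = ATau" "state c (den 0 Inl P') n"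
    then show ?thesis
      using replicates_step[OF n(2) Q(1), of n] by (cases \<mu>) auto
  next
    assume "map_action Inl \<mu> = ATau" "state c (den 0 Inl P') (Suc n)"
    then show ?thesis
      using replicates_step[OF n(2) Q(1), of "Suc n"] by (cases \<mu>) auto
  next
    fix m assume "map_action Inl \<mu> = AOut (Inl c) (Inl c)" "n = Suc m" "state c (den 0 Inl P') m"
    then show ?thesis
      using state_output[of c Q m] n(2) by (cases \<mu>) auto
  qed
  then obtain Q' where Q': "step Q \<mu> Q'" "\<exists>m. state c (den 0 Inl P') m \<and> state c (den 0 Inl Q') m"
    by blast
  have "sstep (den 0 Inl Q) (map_action Inl \<mu>) (den 0 Inl Q')"
    using sstep_of_step[OF Q'(1) below_Inl state_objs[OF n(2)]] by simp
  then have "replicates c (den 0 Inl Q')" "is_proc Q'"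
    using Q replicates_sstep is_proc_step[OF Q'(1)] by simp_all
  with P' Q' show ?thesis
    unfolding family_def by blast
qed

lemma family_sym: "family c P Q \<Longrightarrow> family c Q P"
  by (auto simp: family_def)

lemma bisimulation_family: "bisimulation (family (c :: 'n :: infinite))"
  unfolding bisimulation_def
proof (intro allI impI conjI)
  fix P Q :: "'n pi"
  assume PQ: "family c P Q"
  then show "is_proc P" "is_proc Q"
    by (simp_all add: family_def)
  show "\<exists>Q'. step Q \<mu> Q' \<and> family c P' Q'" if "step P \<mu> P'" for \<mu> P'
    using PQ that by (rule family_step)
  show "\<exists>P'. step P \<mu> P' \<and> family c P' Q'" if Q': "step Q \<mu> Q'" for \<mu> Q'
  proof -
    obtain P' where "step P \<mu> P'" "family c Q' P'"
      using family_step[OF family_sym[OF PQ] Q'] by blast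
    then show ?thesis
      using family_sym[of c Q' P'] by blast
  qed
qed

section \<open>Success is forced\<close>

text \<open>Erasure maps \<open>LObs p\<close> to \<open>p\<close> itself, which would give further
  preimages; \<open>is_lproc\<close> excludes them.\<close>

lemma Unl_eq:
  assumes "is_lproc E"
  shows "Unl E = Par P Q \<longleftrightarrow> (\<exists>F G. E = LPar F G \<and> Unl F = P \<and> Unl G = Q)"
    and "Unl E = Outp x y P \<longleftrightarrow> (\<exists>v F. E = LOutp x y v F \<and> Unl F = P)"
  using assms by (cases E; auto)+

lemma state_live_output:
  fixes E :: "'n :: infinite lterm"
  assumes "is_lproc E" "state c (den 0 Inl (Unl E)) (Suc n)"
  shows "\<exists>v. live v (AOut c c) E"
  using assms
proof (induction E arbitrary: n)
  case (LPar E F)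
  then obtain i j where n: "Suc n = i + j"
    and i: "state c (den 0 Inl (Unl E)) i" and j: "state c (den 0 Inl (Unl F)) j"
    by (auto elim: state_parE)
  show ?case
  proof (cases i)
    case 0
    with n j LPar.IH(2)[of n] LPar.prems obtain v where "live v (AOut c c) F"
      by auto
    then have "live v (AOut c c) (LPar E F)"
      by (simp add: live_Par2)
    then show ?thesis by blast
  next
    case (Suc l)
    with i LPar.IH(1)[of l] LPar.prems obtain v where "live v (AOut c c) E"
      by auto
    then have "live v (AOut c c) (LPar E F)"
      by (simp add: live_Par1)
    then show ?thesis by blast
  qed
next
  case (LNu a E)
  then obtain X Z where P: "den (Suc 0) (Inl(a := Inr 0)) (Unl E) = SPar (SPar X (msg c)) Z"
    by (auto elim!: state_NuE)
  then obtain Q R where "Unl E = Par (Par Q (Outp c c Null)) R" and ac: "a \<noteq> c"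
    by (auto simp: den_eq split: if_splits)
  with LNu.prems(1) obtain F G H v where "E = LPar (LPar F (LOutp c c v G)) H"
    by (auto simp: Unl_eq)
  then have "live v (AOut c c) E"
    by (simp add: live_Par1 live_Par2 live_Output)
  then have "live v (AOut c c) (LNu a E)"
    using ac by (auto simp: act_n_def intro!: live_Res)
  then show ?case by blast
qed (auto elim!: state_others state_BangE)

definition tester :: "'n \<Rightarrow> 'n \<Rightarrow> 'n lterm" where
  "tester a c = LInp c a ([], 0) (LOmg Null)"

text \<open>The state cannot input and the tester cannot act alone. So either the state moves
  internally, or the tester receives an output and exposes \<omega>.\<close>

lemma lstep_tester:
  fixes E :: "'n :: infinite lterm"
  assumes "state c (den 0 Inl (Unl E)) n" "lalpha (tester a c) T" "lstep (LPar E T) ATau S"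
  obtains (success) U where "lstep S AOmg U"
  | (continue) E' T' where "S = LPar E' T'" "lstep E ATau E'" "lalpha (tester a c) T'"
proof -
  have T: "den 0 Inl (Unl T) = SInp (Inl c) (\<lambda>_. SOmg SNull)"
    using den_alpha[OF alpha_Unl[OF assms(2)], of 0 Inl] by (simp add: tester_def)
  then have objs: "objs c (den 0 Inl (Unl T))" by simp
  note E_step = sstep_of_step[OF step_Unl below_Inl state_objs[OF assms(1)]]
  note T_step = sstep_of_step[OF step_Unl below_Inl objs]
  show ?thesis
    using assms(3)
  proof (cases rule: lstep_LParE)
    case (left E' T')
    then show ?thesis
      using continue lalpha_trans[OF assms(2)] by blast
  next
    case (right E' T')
    then show ?thesis
      using T_step[OF right(3)] T by (auto elim: sstep_elims)
  next
    case (com1 x y E' T')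
    then show ?thesis
      using E_step[OF com1(2)] state_sstep[OF assms(1)] by fastforce
  next
    case (com2 x y E' T')
    then have "sstep (SInp (Inl c) (\<lambda>_. SOmg SNull)) (AIn (Inl x) (Inl y)) (den 0 Inl (Unl T'))"
      using T_step[OF com2(3)] T by simp
    then have "den 0 Inl (Unl T') = SOmg SNull"
      by (auto elim: sstep_elims)
    then obtain Q where "Unl T' = Omg Q"
      by (auto simp: den_eq)
    \<comment> \<open>Erasure hides whether \<open>T'\<close> is an \<open>LOmg\<close> or an
      \<open>LObs\<close> term; both can perform \<omega>.\<close>
    then have "\<exists>U. lstep T' AOmg U"
      by (cases T') (auto intro: lstep.intros step.intros)
    then obtain U where "lstep T' AOmg U" ..
    then have "lstep S AOmg (LPar E' U)"
      unfolding com2(1) by (simp add: LPar2)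
    then show ?thesis
      by (rule success)
  next
    case (bound x y G)
    then show ?thesis
      using E_step T_step by fastforce
  qed
qed

definition forced :: "'n \<Rightarrow> 'n \<Rightarrow> 'n pi" where
  "forced a c = Nu a (Par (Par (Outp a c Null) (Inp a a (Outp c c Null))) Null)"

lemma den_forced: "a \<noteq> c \<Longrightarrow> den 0 Inl (forced a c) = cell (trigger c) (guard (msg c)) SNull"
  by (simp add: forced_def)

text \<open>The label is that of the output on \<open>a\<close>: \<open>L\<close> descends to the
  left twice, once for each parallel composition.\<close>

lemma live_forced: "live (s @ [False, False], n) ATau (L (s, n) (forced a c))"
proof -
  have "live (s @ [False, False], n) ATau (LPar
      (LOutp a c (s @ [False, False], n) LNull)
      (LInp a a (s @ [False, True], n) (LOutp c c (s @ [False, True], Suc n) LNull)))"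
    by (rule live_Com2_out[OF live_Input live_Output])
  then show ?thesis
    by (auto simp: forced_def act_n_def intro!: live_Res live_Par1)
qed

text \<open>
  Until the second component has moved, its label is live; from then on an output on \<open>c\<close> is
  available and the label of the tester is live.
\<close>

definition waiting :: "'n \<Rightarrow> 'n \<Rightarrow> label \<Rightarrow> 'n lterm \<Rightarrow> bool" where
  "waiting a c v S \<longleftrightarrow> (\<exists>E F T n. S = LPar (LPar E F) T \<and> lalpha (tester a c) T \<and>
    state c (den 0 Inl (Unl E)) n \<and> lalpha (L v (forced a c)) F \<and> is_lproc E)"

definition ready :: "'n \<Rightarrow> 'n \<Rightarrow> 'n lterm \<Rightarrow> bool" where
  "ready a c S \<longleftrightarrow> (\<exists>E T n. S = LPar E T \<and> lalpha (tester a c) T \<and>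
    state c (den 0 Inl (Unl E)) (Suc n) \<and> is_lproc E)"

lemma waiting_live:
  assumes "waiting a c (s, n) S"
  shows "(s @ [False, False], n) \<in> Ll S"
proof -
  obtain E F T where S: "S = LPar (LPar E F) T" and F: "lalpha (L (s, n) (forced a c)) F"
    using assms by (auto simp: waiting_def)
  have "live (s @ [False, False], n) ATau F"
    using live_Alpha[OF lalpha_sym[OF F] live_forced] .
  then show ?thesis
    unfolding S Ll_def by (simp add: live_Par1 live_Par2)
qed

lemma ready_live:
  fixes S :: "'n :: infinite lterm"
  assumes "ready a c S"
  shows "([], 0) \<in> Ll S"
proof -
  obtain E T n where S: "S = LPar E T" and T: "lalpha (tester a c) T"
    and E: "state c (den 0 Inl (Unl E)) (Suc n)" "is_lproc E"
    using assms by (auto simp: ready_def)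
  obtain w where "live w (AOut c c) E"
    using state_live_output[OF E(2,1)] by blast
  moreover have "live ([], 0) (AIn c c) T"
    using live_Alpha[OF lalpha_sym[OF T]] by (simp add: tester_def live_Input)
  ultimately show ?thesis
    unfolding S Ll_def by (auto intro: live_Com2_in)
qed

text \<open>Internal steps never lower the count; a communication with the tester would enable
  \<omega>, contrary to the last hypothesis.\<close>

lemma ready_step:
  fixes S :: "'n :: infinite lterm"
  assumes "ready a c S" "lstep S ATau S'" "\<nexists>U. lstep S' AOmg U"
  shows "ready a c S'"
proof -
  obtain E T n where S: "S = LPar E T" and T: "lalpha (tester a c) T"
    and E: "state c (den 0 Inl (Unl E)) (Suc n)" "is_lproc E"
    using assms by (auto simp: ready_def)
  from E(1) T assms(2)[unfolded S] show ?thesis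
  proof (cases rule: lstep_tester)
    case (continue E' T')
    have "sstep (den 0 Inl (Unl E)) ATau (den 0 Inl (Unl E'))"
      using sstep_of_step[OF step_Unl[OF continue(2)] below_Inl state_objs[OF E(1)]] by simp
    from state_sstep[OF E(1) this] obtain m where "state c (den 0 Inl (Unl E')) (Suc m)"
      by auto
    then show ?thesis
      using continue is_lproc_lstep[OF continue(2) E(2)] unfolding ready_def by blast
  qed (use assms(3) in blast)
qed

text \<open>While \<open>E\<close> moves, \<open>F\<close> changes only up to alpha-equivalence and
  keeps its labels. The only step of \<open>F\<close> itself produces a message, which makes the
  total count positive.\<close>

lemma waiting_step:
  fixes S :: "'n :: infinite lterm"
  assumes "a \<noteq> c" "waiting a c v S" "lstep S ATau S'" "\<nexists>U. lstep S' AOmg U"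
  shows "waiting a c v S' \<or> ready a c S'"
proof -
  obtain E F T n where S: "S = LPar (LPar E F) T" and T: "lalpha (tester a c) T"
    and E: "state c (den 0 Inl (Unl E)) n" "is_lproc E" and F: "lalpha (L v (forced a c)) F"
    using assms by (auto simp: waiting_def)
  have den_F: "den 0 Inl (Unl F) = cell (trigger c) (guard (msg c)) SNull"
    using den_alpha[OF alpha_Unl[OF F], of 0 Inl] assms(1) by (simp add: Unl_L den_forced)
  then have state_F: "state c (den 0 Inl (Unl F)) 0"
    by (auto intro: state_cell)
  have F_proc: "is_lproc F"
    using is_lproc_lalpha[OF F] by (simp add: is_lproc_L forced_def)
  note E_step = sstep_of_step[OF step_Unl below_Inl state_objs[OF E(1)]]
  note F_step = sstep_of_step[OF step_Unl below_Inl state_objs[OF state_F]]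
  have EF: "state c (den 0 Inl (Unl (LPar E F))) n"
    using state_par[OF E(1) state_F] by simp
  from EF T assms(3)[unfolded S] show ?thesis
  proof (cases rule: lstep_tester)
    case (continue G T')
    from continue(2) show ?thesis
    proof (cases rule: lstep_LParE)
      case (left E' F')
      obtain m where "state c (den 0 Inl (Unl E')) m"
        using state_sstep[OF E(1)] E_step[OF left(2)] by auto
      then have "waiting a c v S'"
        using continue left is_lproc_lstep[OF left(2) E(2)] lalpha_trans[OF F]
        unfolding waiting_def by blast
      then show ?thesis ..
    next
      case (right E' F')
      have "den 0 Inl (Unl F') = cell SNull (msg c) SNull"
        using F_step[OF right(3)] unfolding den_F by (blast dest: forced_sstep)
      then have "state c (den 0 Inl (Unl F')) 1"
        by (auto intro: state_msg[simplified])
      moreover have "state c (den 0 Inl (Unl E')) n"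
        using den_alpha[OF alpha_Unl[OF right(2)], of 0 Inl] E(1) by simp
      ultimately have "state c (den 0 Inl (Unl G)) (Suc n)"
        using state_par[of c "den 0 Inl (Unl E')" n "den 0 Inl (Unl F')" 1] right(1) by simp
      moreover have "is_lproc G"
        using right is_lproc_lalpha[OF right(2)] E(2) is_lproc_lstep[OF right(3) F_proc] by simp
      ultimately have "ready a c S'"
        using continue unfolding ready_def by blast
      then show ?thesis ..
    next
      case (com1 x y E' F')
      then show ?thesis
        using E_step[OF com1(2)] state_sstep[OF E(1)] by fastforce
    next
      case (com2 x y E' F')
      then show ?thesis
        using F_step[OF com2(3)] state_sstep[OF state_F] by fastforce
    next
      case (bound x y H)
      then show ?thesis
        using E_step F_step by fastforce
    qed
  qed (use assms(4) in blast)
qed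

text \<open>Without success, either \<open>ready\<close> holds from some state on or
  \<open>waiting\<close> holds throughout. In both cases one fixed label stays live, which
  contradicts weak fairness for finite and infinite computations alike.\<close>

lemma waiting_success:
  fixes S :: "nat \<Rightarrow> 'n :: infinite lterm"
  assumes "a \<noteq> c" "max_comp S N" "weak_fair S N" "waiting a c v (S 0)"
  shows "\<exists>i. enat i \<le> N \<and> (\<exists>U. lstep (S i) AOmg U)"
proof (rule ccontr)
  assume "\<not> ?thesis"
  then have no: "\<nexists>U. lstep (S i) AOmg U" if "enat i \<le> N" for i
    using that by blast
  have step: "lstep (S i) ATau (S (Suc i))" if "enat (Suc i) \<le> N" for i
    using assms(2) that by (simp add: max_comp_def Suc_ile_eq)
  have le: "enat i \<le> N" if "enat (Suc i) \<le> N" for i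
    using that by (simp add: Suc_ile_eq)
  have inv: "waiting a c v (S i) \<or> ready a c (S i)" if "enat i \<le> N" for i
    using that
  proof (induction i)
    case (Suc i)
    then show ?case
      using waiting_step[OF assms(1) _ step no] ready_step[OF _ step no] le by blast
  qed (use assms(4) in simp)
  show False
  proof (cases "\<exists>i. enat i \<le> N \<and> ready a c (S i)")
    case True
    then obtain i where i: "enat i \<le> N" "ready a c (S i)" by blast
    have "ready a c (S j)" if "i \<le> j" "enat j \<le> N" for j
      using that
    proof (induction j rule: dec_induct)
      case (step j)
      then show ?case
        using ready_step[OF _ \<open>\<And>i. enat (Suc i) \<le> N \<Longrightarrow> lstep (S i) ATau (S (Suc i))\<close> no] le
        by blast
    qed (use i in simp)
    then show False
      using assms(3) i(1) ready_live unfolding weak_fair_def by blast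
  next
    case False
    then have "waiting a c (fst v, snd v) (S i)" if "enat i \<le> N" for i
      using inv that by auto
    then show False
      using assms(3) waiting_live unfolding weak_fair_def by (metis zero_le enat_0)
  qed
qed

section \<open>Success is avoidable\<close>

definition chooser :: "'n \<Rightarrow> 'n \<Rightarrow> 'n pi" where
  "chooser a c = Nu a (Par (Par (Outp a c Null) (Inp a a (Outp c c Null))) (Inp a a Null))"

text \<open>What a copy leaves behind once its trigger has met the empty branch: the guard before
  the output on \<open>c\<close> can no longer fire.\<close>

definition rest :: "'n \<Rightarrow> 'n \<Rightarrow> 'n pi" where
  "rest a c = Nu a (Par (Par Null (Inp a a (Outp c c Null))) Null)"

text \<open>The process after \<open>i\<close> unfoldings in which every copy took the empty branch;
  the labels follow \<open>LRep\<close>.\<close>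

primrec unrolled :: "'n \<Rightarrow> 'n \<Rightarrow> nat \<Rightarrow> label \<Rightarrow> 'n lterm" where
  "unrolled a c 0 v = LBang v (chooser a c)"
| "unrolled a c (Suc i) v = LPar (L (fst v @ [False], snd v + 1) (rest a c))
     (unrolled a c i (fst v @ [True], snd v + 1))"

lemma den_chooser: "a \<noteq> c \<Longrightarrow> den 0 Inl (chooser a c) = choice c"
  by (simp add: chooser_def)

lemma den_rest: "a \<noteq> c \<Longrightarrow> den 0 Inl (rest a c) = cell SNull (guard (msg c)) SNull"
  by (simp add: rest_def)

lemma chooser_step: "step (chooser a c) ATau (rest a c)"
proof -
  have "step (Inp a a Null) (AIn a c) Null"
    using Input[of a a Null c] by (simp add: subst1_def)
  then show ?thesis
    unfolding chooser_def rest_def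
    by (intro Res Com2[of _ a c] Par1 Output) (auto simp: act_n_def)
qed

lemma lstep_unrolled: "lstep (unrolled a c i v) ATau (unrolled a c (Suc i) v)"
proof (induction i arbitrary: v)
  case 0
  then show ?case
    using LRep[OF chooser_step, of "fst v" "snd v" a c] by simp
next
  case (Suc i)
  show ?case
    unfolding unrolled.simps(2)[of a c "Suc i"] unrolled.simps(2)[of a c i v]
    by (rule LPar2[OF Suc.IH]) simp
qed

lemma state_unrolled: "a \<noteq> c \<Longrightarrow> state c (den 0 Inl (Unl (unrolled a c i v))) 0"
proof (induction i arbitrary: v)
  case 0
  then show ?case
    by (simp add: den_chooser state_bang)
next
  case (Suc i)
  have "state c (den 0 Inl (rest a c)) 0"
    using Suc.prems by (auto simp: den_rest intro: state_cell)
  then show ?case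
    using state_par[OF _ Suc.IH[OF Suc.prems]] by (fastforce simp: Unl_L)
qed

lemma state_live:
  fixes E :: "'n :: infinite lterm"
  assumes "state c (den 0 Inl (Unl E)) 0" "live v \<mu> E"
  shows "\<mu> = ATau"
proof -
  obtain D where "sstep (den 0 Inl (Unl E)) (map_action Inl \<mu>) D"
    using sstep_of_live[OF assms(2) below_Inl state_objs[OF assms(1)]] by blast
  from state_sstep[OF assms(1) this] show ?thesis
    by (cases \<mu>) auto
qed

lemma rest_not_live:
  fixes a c :: "'n :: infinite"
  assumes "a \<noteq> c"
  shows "\<not> live w \<mu> (L v (rest a c))"
proof
  assume "live w \<mu> (L v (rest a c))"
  moreover have "objs c (den 0 Inl (Unl (L v (rest a c))))"
    using assms by (simp add: Unl_L den_rest)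
  ultimately show False
    using sstep_of_live[OF _ below_Inl] assms dead_sstep by (fastforce simp: Unl_L den_rest)
qed

text \<open>The residues are stuck and contribute no label; the single replication carries a number
  that grows by one with each unfolding.\<close>

lemma live_unrolled:
  fixes a c :: "'n :: infinite"
  assumes "a \<noteq> c" "live w \<mu> (unrolled a c i v)"
  shows "snd w = snd v + i"
  using assms(2)
proof (induction i arbitrary: v)
  case 0
  then show ?case
    using live_LBang by fastforce
next
  case (Suc i)
  from Suc.prems have "live w \<mu> (LPar (L (fst v @ [False], snd v + 1) (rest a c))
      (unrolled a c i (fst v @ [True], snd v + 1)))"
    by simp
  then show ?case
  proof (cases rule: live_LParE)
    case right
    then show ?thesis
      using Suc.IH by fastforce
  qed (use rest_not_live[OF assms(1)] in blast)+
qed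

text \<open>At count 0 there is no output for the tester to receive, so the tester adds no live
  label.\<close>

lemma live_unrolled_tester:
  fixes a c :: "'n :: infinite"
  assumes "a \<noteq> c" "live w ATau (LPar (unrolled a c i v) (tester a c))"
  shows "snd w = snd v + i"
  using assms(2)
proof (cases rule: live_LParE)
  case left
  then show ?thesis
    by (rule live_unrolled[OF assms(1)])
next
  case right
  then obtain D where "sstep (den 0 Inl (Unl (tester a c))) ATau D"
    using sstep_of_live[OF right below_Inl, of c] by (auto simp: tester_def)
  then show ?thesis
    by (auto simp: tester_def elim: sstep_elims)
next
  case (com1 w1 w2 x y)
  then show ?thesis
    using state_live[OF state_unrolled[OF assms(1)]] by blast
next
  case (com2 w1 w2 x y)
  then show ?thesis
    using state_live[OF state_unrolled[OF assms(1)]] by blast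
qed

lemma unrolled_no_success:
  fixes a c :: "'n :: infinite"
  assumes "a \<noteq> c"
  shows "\<not> lstep (LPar (unrolled a c i v) (tester a c)) AOmg S"
proof
  assume *: "lstep (LPar (unrolled a c i v) (tester a c)) AOmg S"
  have "objs c (den 0 Inl (Unl (LPar (unrolled a c i v) (tester a c))))"
    using state_objs[OF state_unrolled[OF assms]] by (simp add: tester_def)
  from sstep_of_step[OF step_Unl[OF *] below_Inl this]
  have "sstep (SPar (den 0 Inl (Unl (unrolled a c i v))) (SInp (Inl c) (\<lambda>_. SOmg SNull))) AOmg
      (den 0 Inl (Unl S))"
    by (simp add: tester_def)
  then show False
    using state_sstep[OF state_unrolled[OF assms]] by (fastforce elim: sstep_elims)
qed

lemma not_sfmust_bang:
  fixes a c :: "'n :: infinite"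
  assumes "a \<noteq> c"
  shows "\<not> sfmust (LBang v (chooser a c)) (tester a c)"
proof -
  define S where "S i = LPar (unrolled a c i v) (tester a c)" for i
  have "max_comp S \<infinity>"
    by (simp add: max_comp_def S_def LPar1 lstep_unrolled del: unrolled.simps)
  moreover have "S 0 = LPar (LBang v (chooser a c)) (tester a c)"
    by (simp add: S_def)
  moreover have "strong_fair S \<infinity>"
    unfolding strong_fair_def
  proof
    fix w
    \<comment> \<open>Every label live at index \<open>j\<close> has number
      \<open>snd v + j\<close>, which exceeds \<open>snd w\<close> as soon as \<open>j\<close>
      does.\<close>
    have "w \<notin> Ll (S j)" if "Suc (snd w) \<le> j" for j
      using that live_unrolled_tester[OF assms, of w j v] by (auto simp: Ll_def S_def)
    then show "\<exists>i. enat i \<le> \<infinity> \<and> (\<forall>j\<ge>i. enat j \<le> \<infinity> \<longrightarrow> w \<notin> Ll (S j))"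
      by auto
  qed
  moreover have "\<nexists>U. lstep (S i) AOmg U" for i
    using unrolled_no_success[OF assms] by (simp add: S_def)
  ultimately show ?thesis
    unfolding sfmust_def by blast
qed

text \<open>Lets a single test separate the two processes under both notions: success is shown under
  weak fairness and failure under strong fairness.\<close>

lemma wfmust_imp_sfmust: "wfmust E \<rho> \<Longrightarrow> sfmust E \<rho>"
  unfolding wfmust_def sfmust_def using strong_imp_weak_fair by blast

theorem theorem7p4:
  shows "\<exists>E F :: ('n :: infinite) lterm. E \<in> Pe \<and> F \<in> Pe \<and>
    bisimilar (Unl E) (Unl F) \<and> \<not> test_equiv wfmust E F \<and> \<not> test_equiv sfmust E F"
proof -
  fix c :: 'n
  obtain a where ac: "a \<noteq> c"
    using ex_new_if_finite[of "{c}"] infinite_UNIV by auto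
  define E where "E = L ([], 0) (Par (Bang (chooser a c)) (forced a c))"
  define F where "F = L ([], 0) (Bang (chooser a c))"
  have E: "E = LPar (LBang ([False], 0) (chooser a c)) (L ([True], 0) (forced a c))"
    and F: "F = LBang ([], 0) (chooser a c)"
    by (simp_all add: E_def F_def)
  have proc: "is_proc (chooser a c)" "is_proc (forced a c)"
    by (simp_all add: chooser_def forced_def)
  \<comment> \<open>The rules \<open>wfl_Inp\<close> and \<open>wfl_Outp\<close> speak of images of
    \<open>L\<close>; these are the evaluated forms that occur in the term.\<close>
  have "wfl (LInp a a v (LOutp c c (fst v, Suc (snd v)) LNull))" for v
    using wfl_Inp[of v a a "Outp c c Null"] by simp
  moreover have "wfl (LOutp a c v LNull)" for v
    using wfl_Outp[of v a c Null] by simp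
  ultimately have "wfl (L ([True], 0) (forced a c))"
    unfolding forced_def by (auto intro!: wfl.intros(5,6) wfl_Null simp: unrelated_def)
  then have "wfl E"
    unfolding E by (intro wfl_Par wfl_Bang) (auto simp: unrelated_def forced_def)
  then have "E \<in> Pe"
    using proc by (simp add: Pe_def E is_lproc_L)
  moreover have "F \<in> Pe"
    using proc by (simp add: Pe_def F wfl_Bang)
  moreover have "family c (Unl E) (Unl F)"
  proof -
    \<comment> \<open>Before its first step the added component offers no output, so both sides have
      count 0.\<close>
    have forced: "state c (den 0 Inl (forced a c)) 0"
      using ac by (auto simp: den_forced intro: state_cell)
    show ?thesis
      using state_par[OF state_bang forced] state_bang[of c] proc ac
      by (auto simp: family_def E F Unl_L den_chooser)
  qed
  then have "bisimilar (Unl E) (Unl F)"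
    using bisimulation_family unfolding bisimilar_def by blast
  moreover have tester: "tester a c \<in> Oe"
    using wfl_Inp[of "([], 0)" c a "Omg Null"] by (simp add: Oe_def tester_def)
  moreover have "wfmust E (tester a c)"
    unfolding wfmust_def
  proof (intro allI impI)
    fix S N
    assume S: "max_comp S N \<and> S 0 = LPar E (tester a c) \<and> weak_fair S N"
    moreover have "waiting a c ([True], 0) (S 0)"
      using S ac proc state_bang[of c] lalpha_refl
      by (auto simp: waiting_def E den_chooser)
    ultimately show "\<exists>i. enat i \<le> N \<and> (\<exists>T. lstep (S i) AOmg T)"
      using waiting_success[OF ac] by blast
  qed
  moreover have "\<not> sfmust F (tester a c)"
    unfolding F by (rule not_sfmust_bang[OF ac])
  ultimately show ?thesis
    unfolding test_equiv_def using wfmust_imp_sfmust by blast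
qed

end
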